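(* Let $E$ and $F$ be Banach lattices and let $\mathcal{S},\mathcal{T}\subset\mathrm{L}_+(E,F)$ be such that $\mathcal{S}$ is dominated by $\mathcal{T}$. The following hold. $(i_1)$ If $E$ is a KB-space, then $\mathcal{T}\in\mathbf{a\text{-}Lwc}(E,F)\Longrightarrow\mathcal{S}\in\mathbf{a\text{-}Lwc}(E,F)$. $(i_2)$ $\mathcal{T}\in\mathbf{l\text{-}Lwc}(E,F)\Longrightarrow\mathcal{S}\in\mathbf{l\text{-}Lwc}(E,F)$. $(ii_2)$ $\mathcal{T}\in\mathbf{l\text{-}Mwc}(E,F)\Longrightarrow\mathcal{S}\in\mathbf{l\text{-}Mwc}(E,F)$. $(i_3)$ $\mathcal{T}\in\mathbf{o\text{-}Lwc}(E,F)\Longrightarrow\mathcal{S}\in\mathbf{o\text{-}Lwc}(E,F)$. $(ii_3)$ $\mathcal{T}\in\mathbf{o\text{-}Mwc}(E,F)\Longrightarrow\mathcal{S}\in\mathbf{o\text{-}Mwc}(E,F)$.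
   Context: All vector spaces are real and all operators are linear and bounded. $\mathrm{L}(E,F)$ is the space of bounded operators from $E$ to $F$ and $\mathrm{L}_+(E,F)$ is the set of positive operators in it; $F'$ is the norm dual; $B_E$ is the closed unit ball of $E$. In a Banach lattice, a sequence $(x_n)$ is disjoint if $|x_n|\wedge|x_m|=0$ for $n\ne m$. A Banach lattice is a KB-space if every norm bounded increasing sequence of positive elements is norm convergent. Domination: for $\mathcal{S},\mathcal{T}\subseteq\mathrm{L}_+(E,F)$, $\mathcal{S}$ is dominated by $\mathcal{T}$ if for each $S\in\mathcal{S}$ there exists $T\in\mathcal{T}$ with $S\le T$. A subset $A$ of a Banach lattice $F$ is L-weakly compact (an Lwc set) if every disjoint sequence in its solid hull $\mathrm{sol}(A)=\bigcup_{a\in A}[-|a|,|a|]$ is norm-null. A subset $A$ of a Banach space $X$ is limited if for every weak$^*$-null sequence $(f_n)$ in $X'$ one has $f_n\to 0$ uniformly on $A$. For a set $\mathcal{T}$ of operators, $\mathcal{T}A=\bigcup_{T\in\mathcal{T}}T(A)$. A (norm) bounded subset $\mathcal{T}$ of $\mathrm{L}(E,F)$ belongs to: - $\mathbf{a\text{-}Lwc}(E,F)$ if $\mathcal{T}A$ is an Lwc set for each relatively weakly compact $A\subseteq E$; - $\mathbf{l\text{-}Lwc}(E,F)$ if $\mathcal{T}A$ is an Lwc set for each limited $A\subseteq E$; - $\mathbf{o\text{-}Lwc}(E,F)$ if $\mathcal{T}A$ is an Lwc set for each order bounded $A\subseteq E$; - $\mathbf{l\text{-}Mwc}(E,F)$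 if $\sup_{T\in\mathcal{T}}|f(Tx_n)|\to 0$ for every $f\in F'$ and every disjoint sequence $(x_n)$ in $B_E$; - $\mathbf{o\text{-}Mwc}(E,F)$ if $\sup_{T\in\mathcal{T}}|f_n(Tx_n)|\to 0$ for every order bounded sequence $(f_n)$ in $F'$ and every disjoint sequence $(x_n)$ in $B_E$. In particular, membership in each of these classes includes norm boundedness of the set of operators. *)

theory Defs
  imports "HOL-Analysis.Analysis" "HOL-Library.Lattice_Algebras"
begin

class banach_lattice = banach + ordered_real_vector + lattice_ab_group_add_abs +
  assumes norm_mono_abs: "\<bar>x\<bar> \<le> \<bar>y\<bar> \<Longrightarrow> norm x \<le> norm y"

instance real :: banach_lattice
  by standard (auto simp: abs_if sup_real_def)

definition disjoint_seq :: "(nat \<Rightarrow> 'a::banach_lattice) \<Rightarrow> bool" where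
  "disjoint_seq x \<longleftrightarrow> (\<forall>n m. n \<noteq> m \<longrightarrow> inf \<bar>x n\<bar> \<bar>x m\<bar> = 0)"

definition KB_space :: "'a::banach_lattice itself \<Rightarrow> bool" where
  "KB_space _ \<longleftrightarrow>
     (\<forall>x :: nat \<Rightarrow> 'a. incseq x \<and> (\<forall>n. 0 \<le> x n) \<and> bounded (range x) \<longrightarrow> convergent x)"

definition solid_hull :: "'a::banach_lattice set \<Rightarrow> 'a set" where
  "solid_hull A = (\<Union>a\<in>A. {- \<bar>a\<bar>..\<bar>a\<bar>})"

definition Lwc_set :: "'a::banach_lattice set \<Rightarrow> bool" where
  "Lwc_set A \<longleftrightarrow> (\<forall>x. disjoint_seq x \<and> range x \<subseteq> solid_hull A \<longrightarrow> x \<longlonglongrightarrow> 0)"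

definition order_bounded :: "'a::order set \<Rightarrow> bool" where
  "order_bounded A \<longleftrightarrow> (\<exists>a b. A \<subseteq> {a..b})"

text \<open>The coarsest topology making all bounded functionals continuous, obtained by pulling
  back the product topology along the evaluation map.\<close>

definition weak_topology :: "'a::real_normed_vector topology" where
  "weak_topology = pullback_topology UNIV (\<lambda>x (f :: 'a \<Rightarrow>\<^sub>L real). blinfun_apply f x) euclidean"

definition relatively_weakly_compact :: "'a::real_normed_vector set \<Rightarrow> bool" where
  "relatively_weakly_compact A \<longleftrightarrow> compactin weak_topology (weak_topology closure_of A)"

definition weak_star_null :: "(nat \<Rightarrow> 'a::real_normed_vector \<Rightarrow>\<^sub>L real) \<Rightarrow> bool" where
  "weak_star_null f \<longleftrightarrow> (\<forall>x. (\<lambda>n. blinfun_apply (f n) x) \<longlonglongrightarrow> 0)"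

definition limited_set :: "'a::real_normed_vector set \<Rightarrow> bool" where
  "limited_set A \<longleftrightarrow>
     (\<forall>f. weak_star_null f \<longrightarrow> uniform_limit A (\<lambda>n. blinfun_apply (f n)) (\<lambda>_. 0) sequentially)"

definition op_le :: "('a::banach_lattice \<Rightarrow>\<^sub>L 'b::banach_lattice) \<Rightarrow> ('a \<Rightarrow>\<^sub>L 'b) \<Rightarrow> bool" where
  "op_le S T \<longleftrightarrow> (\<forall>x\<ge>0. blinfun_apply S x \<le> blinfun_apply T x)"

definition positive_operators :: "('a::banach_lattice \<Rightarrow>\<^sub>L 'b::banach_lattice) set" where
  "positive_operators = {T. op_le 0 T}"

definition dominated_by ::
  "('a::banach_lattice \<Rightarrow>\<^sub>L 'b::banach_lattice) set \<Rightarrow> ('a \<Rightarrow>\<^sub>L 'b) set \<Rightarrow> bool" where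
  "dominated_by \<S> \<T> \<longleftrightarrow> (\<forall>S\<in>\<S>. \<exists>T\<in>\<T>. op_le S T)"

definition order_bounded_functionals :: "(nat \<Rightarrow> 'a::banach_lattice \<Rightarrow>\<^sub>L real) \<Rightarrow> bool" where
  "order_bounded_functionals f \<longleftrightarrow> (\<exists>g h. \<forall>n. op_le g (f n) \<and> op_le (f n) h)"

definition operators_image ::
  "('a::real_normed_vector \<Rightarrow>\<^sub>L 'b::real_normed_vector) set \<Rightarrow> 'a set \<Rightarrow> 'b set" where
  "operators_image \<T> A = (\<Union>T\<in>\<T>. blinfun_apply T ` A)"

definition a_Lwc :: "('a::banach_lattice \<Rightarrow>\<^sub>L 'b::banach_lattice) set set" where
  "a_Lwc = {\<T>. bounded \<T> \<and> (\<forall>A. relatively_weakly_compact A \<longrightarrow> Lwc_set (operators_image \<T> A))}"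

definition l_Lwc :: "('a::banach_lattice \<Rightarrow>\<^sub>L 'b::banach_lattice) set set" where
  "l_Lwc = {\<T>. bounded \<T> \<and> (\<forall>A. limited_set A \<longrightarrow> Lwc_set (operators_image \<T> A))}"

definition o_Lwc :: "('a::banach_lattice \<Rightarrow>\<^sub>L 'b::banach_lattice) set set" where
  "o_Lwc = {\<T>. bounded \<T> \<and> (\<forall>A. order_bounded A \<longrightarrow> Lwc_set (operators_image \<T> A))}"

text \<open>The suprema are taken in \<^typ>\<open>ennreal\<close>, where the supremum over an empty set of operators
  is 0; in \<^typ>\<open>real\<close> it would be unspecified.\<close>

definition l_Mwc :: "('a::banach_lattice \<Rightarrow>\<^sub>L 'b::banach_lattice) set set" where
  "l_Mwc = {\<T>. bounded \<T> \<and>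
     (\<forall>(f :: 'b \<Rightarrow>\<^sub>L real) x. disjoint_seq x \<and> range x \<subseteq> cball 0 1 \<longrightarrow>
        (\<lambda>n. SUP T\<in>\<T>. ennreal \<bar>f (blinfun_apply T (x n))\<bar>) \<longlonglongrightarrow> 0)}"

definition o_Mwc :: "('a::banach_lattice \<Rightarrow>\<^sub>L 'b::banach_lattice) set set" where
  "o_Mwc = {\<T>. bounded \<T> \<and>
     (\<forall>(f :: nat \<Rightarrow> 'b \<Rightarrow>\<^sub>L real) x.
        order_bounded_functionals f \<and> disjoint_seq x \<and> range x \<subseteq> cball 0 1 \<longrightarrow>
        (\<lambda>n. SUP T\<in>\<T>. ennreal \<bar>f n (blinfun_apply T (x n))\<bar>) \<longlonglongrightarrow> 0)}"

end

theory Submission imports Defs begin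

text \<open>The lattice seminorm \<open>p\<^sub>y x = sup\<^sub>k \<parallel>\<bar>x\<bar> \<and> k\<bar>y\<bar>\<parallel>\<close> plays the role of the norm of the projection of
  \<open>x\<close> to the band of \<open>y\<close>. For disjoint \<open>y\<^sub>n\<close> and \<open>u\<^sub>n\<close> in an Lwc set, \<open>p\<^sub>y\<^sub>n u\<^sub>n \<rightarrow> 0\<close>, and a functional dominated by
  \<open>p\<^sub>y\<close> can norm any given vector (Hahn-Banach).

  Limited sets: if \<open>\<bar>y\<^sub>n\<bar> \<le> \<bar>S\<^sub>n a\<^sub>n\<bar>\<close>, choose \<open>h\<^sub>n \<le> p\<^sub>y\<^sub>n\<close> norming \<open>S\<^sub>n a\<^sub>n\<close>. As \<open>\<S>{x}\<close> is an Lwc set by domination,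
  \<open>h\<^sub>n \<circ> S\<^sub>n\<close> is weak* null, hence uniformly null on the limited set.

  Weakly compact sets: disjoint sequences in the solid hull of a relatively weakly compact set \<open>A\<close> are
  weakly null. If \<open>\<bar>y\<^sub>n\<bar> \<le> T\<^sub>n\<bar>a\<^sub>n\<bar>\<close> with \<open>\<parallel>y\<^sub>n\<parallel> \<ge> \<epsilon>\<close>, a subsequence of \<open>\<bar>a\<^sub>n\<bar>\<close> can be disjointified to some
  \<open>b\<^sub>k\<close> in the solid hull of \<open>A\<close> while \<open>p\<^sub>y (T b\<^sub>k)\<close> stays away from zero along it, although \<open>\<T>{b\<^sub>k}\<close> is an Lwc set.
  Hence \<open>\<T>\<bar>A\<bar>\<close> is an Lwc set, and it dominates \<open>\<S>A\<close>.

  The remaining cases reduce to \<open>\<bar>S x\<bar> \<le> T\<bar>x\<bar>\<close> and \<open>\<bar>f x\<bar> \<le> \<bar>f\<bar>\<bar>x\<bar>\<close>.\<close>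

subsection \<open>Vector lattices and lattice seminorms\<close>

text \<open>Multiplication by \<open>c > 0\<close> is an order isomorphism, so it commutes with
  meets; the nontrivial inequality comes from applying the inverse scalar.\<close>

lemma inf_scaleR_nonneg:
  fixes x y :: "'a::banach_lattice"
  assumes "0 \<le> c"
  shows "inf (c *\<^sub>R x) (c *\<^sub>R y) = c *\<^sub>R inf x y"
proof (cases "c = 0")
  case False
  with assms have c: "0 < c" by simp
  show ?thesis
  proof (rule antisym)
    have "inverse c *\<^sub>R inf (c *\<^sub>R x) (c *\<^sub>R y) \<le> x" "inverse c *\<^sub>R inf (c *\<^sub>R x) (c *\<^sub>R y) \<le> y"
      using c scaleR_left_mono[of "inf (c *\<^sub>R x) (c *\<^sub>R y)" "c *\<^sub>R x" "inverse c"]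
        scaleR_left_mono[of "inf (c *\<^sub>R x) (c *\<^sub>R y)" "c *\<^sub>R y" "inverse c"] by auto
    then have "c *\<^sub>R inverse c *\<^sub>R inf (c *\<^sub>R x) (c *\<^sub>R y) \<le> c *\<^sub>R inf x y"
      using c by (intro scaleR_left_mono le_infI) auto
    then show "inf (c *\<^sub>R x) (c *\<^sub>R y) \<le> c *\<^sub>R inf x y" using c by simp
  next
    show "c *\<^sub>R inf x y \<le> inf (c *\<^sub>R x) (c *\<^sub>R y)"
      using c by (intro le_infI scaleR_left_mono) auto
  qed
qed simp

lemma abs_scaleR:
  fixes x :: "'a::banach_lattice"
  shows "\<bar>c *\<^sub>R x\<bar> = \<bar>c\<bar> *\<^sub>R \<bar>x\<bar>"
proof -
  have *: "\<bar>c *\<^sub>R x\<bar> = c *\<^sub>R \<bar>x\<bar>" if "0 \<le> c" for c and x :: 'a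
  proof -
    have "\<bar>c *\<^sub>R x\<bar> = - inf (c *\<^sub>R (- x)) (c *\<^sub>R x)"
      by (simp add: abs_lattice neg_inf_eq_sup)
    also have "\<dots> = c *\<^sub>R (- inf (- x) x)"
      by (subst inf_scaleR_nonneg[OF that]) (simp only: scaleR_minus_right)
    also have "\<dots> = c *\<^sub>R \<bar>x\<bar>" by (simp only: abs_lattice neg_inf_eq_sup minus_minus)
    finally show ?thesis .
  qed
  show ?thesis
  proof (cases "0 \<le> c")
    case False
    have "\<bar>c *\<^sub>R x\<bar> = \<bar>(- c) *\<^sub>R x\<bar>" by simp
    also have "\<dots> = \<bar>c\<bar> *\<^sub>R \<bar>x\<bar>" using False by (subst *) auto
    finally show ?thesis .
  qed (simp add: *)
qed

lemma norm_abs_banach_lattice [simp]: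
  fixes x :: "'a::banach_lattice"
  shows "norm \<bar>x\<bar> = norm x"
  by (rule antisym; rule norm_mono_abs) simp_all

lemma norm_mono_nonneg:
  fixes x y :: "'a::banach_lattice"
  shows "0 \<le> x \<Longrightarrow> x \<le> y \<Longrightarrow> norm x \<le> norm y"
  by (rule norm_mono_abs) (use order_trans[of 0 x y] in \<open>simp add: abs_of_nonneg\<close>)

lemma pprt_eq_diff_inf:
  fixes x y :: "'a::lattice_ab_group_add"
  shows "pprt (x - y) = x - inf x y"
  by (simp add: pprt_def diff_inf_eq_sup add_sup_distrib_left sup_commute)

text \<open>With \<open>w = inf (a + b) c\<close>, the difference \<open>w - inf b c\<close> is
  \<open>sup (w - b) (w - c)\<close>, and both \<open>w - b\<close> and \<open>w - c\<close> lie
  below \<open>a\<close> and below \<open>c\<close>. This gives the subadditivity of band seminorms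
  and the disjointness of sums.\<close>

lemma inf_add_le_add_inf:
  fixes a b c :: "'a::lattice_ab_group_add"
  assumes "0 \<le> a" "0 \<le> b" "0 \<le> c"
  shows "inf (a + b) c \<le> inf a c + inf b c"
proof -
  define w where "w = inf (a + b) c"
  have wc: "w \<le> c" and wab: "w \<le> a + b" by (simp_all add: w_def)
  have w0: "w - c \<le> 0" using wc by simp
  have wb: "w - b \<le> w" using assms(2) by simp
  have "w - inf b c = sup (w - b) (w - c)"
    by (simp only: diff_inf_eq_sup add_sup_distrib_left) simp
  also have "\<dots> \<le> inf a c"
  proof (intro le_supI le_infI)
    show "w - b \<le> a" using wab by (simp only: diff_le_eq)
    show "w - c \<le> a" using w0 assms(1) by (rule order_trans)
    show "w - b \<le> c" using wb wc by (rule order_trans)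
    show "w - c \<le> c" using w0 assms(3) by (rule order_trans)
  qed
  finally show ?thesis by (simp only: diff_le_eq w_def)
qed

text \<open>The first summand is \<open>z\<close> truncated to the interval from \<open>- a\<close>
  to \<open>a\<close>; the second is the excess, which \<open>b\<close> has to absorb.\<close>

lemma riesz_decomposition:
  fixes z a b :: "'a::lattice_ab_group_add_abs"
  assumes "0 \<le> a" "0 \<le> b" "\<bar>z\<bar> \<le> a + b"
  obtains u v where "z = u + v" "\<bar>u\<bar> \<le> a" "\<bar>v\<bar> \<le> b"
proof
  let ?u = "inf (sup z (- a)) a"
  have z: "z \<le> a + b" "- z \<le> a + b" using assms(3) abs_le_iff by blast+
  show "z = ?u + (z - ?u)" by (simp only: add_diff_eq add_diff_cancel_left')
  show "\<bar>?u\<bar> \<le> a"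
  proof (rule abs_leI)
    have "- a \<le> ?u" using assms(1) by (intro le_infI) (auto intro: order_trans[of _ 0])
    then show "- ?u \<le> a" by (metis minus_le_iff)
  qed simp
  have eq: "z - ?u = sup (inf 0 (z + a)) (z - a)"
    by (simp only: diff_inf_eq_sup diff_sup_eq_inf neg_sup_eq_inf add_sup_inf_distribs) (simp add: add_sup_inf_distribs)
  show "\<bar>z - ?u\<bar> \<le> b"
  proof (rule abs_leI)
    show "z - ?u \<le> b" unfolding eq
      using z assms by (intro le_supI) (auto simp: diff_le_eq add.commute intro: order_trans[OF inf_le1])
    have "- z - a \<le> b" using z(2) by (simp add: diff_le_eq add.commute)
    then have "- b \<le> - (- z - a)" by (simp only: neg_le_iff_le)
    then have "- b \<le> inf 0 (z + a)"
      using assms(2) by (intro le_infI) (simp_all add: add.commute)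
    then have "- b \<le> z - ?u" unfolding eq by (rule le_supI1)
    then show "- (z - ?u) \<le> b" using minus_le_iff by blast
  qed
qed

lemma inf_scaleR_eq_zero:
  fixes x y :: "'a::banach_lattice"
  assumes "0 \<le> x" "0 \<le> y" "inf x y = 0" "0 \<le> c" "0 \<le> d"
  shows "inf (c *\<^sub>R x) (d *\<^sub>R y) = 0"
proof (rule antisym)
  have "inf (c *\<^sub>R x) (d *\<^sub>R y) \<le> inf (max c d *\<^sub>R x) (max c d *\<^sub>R y)"
    by (rule inf_mono) (auto intro: scaleR_right_mono assms)
  also have "\<dots> = 0"
    using assms by (subst inf_scaleR_nonneg) (auto simp: max_def)
  finally show "inf (c *\<^sub>R x) (d *\<^sub>R y) \<le> 0" .
  show "0 \<le> inf (c *\<^sub>R x) (d *\<^sub>R y)" using assms by (auto intro: scaleR_nonneg_nonneg)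
qed

lemma inf_eq_zero_mono:
  fixes x y :: "'a::lattice_ab_group_add"
  assumes "inf x y = 0" "0 \<le> u" "u \<le> x" "0 \<le> v" "v \<le> y"
  shows "inf u v = 0"
  by (rule antisym) (use assms inf_mono[of u x v y] in auto)

text \<open>The factor may depend on \<open>n\<close>; this allows truncations at multiples
  \<open>k n *\<^sub>R \<bar>y n\<bar>\<close> with varying \<open>k n\<close>.\<close>

lemma disjoint_seq_mono:
  assumes "disjoint_seq y" "\<And>n. 0 \<le> c n" "\<And>n. \<bar>x n\<bar> \<le> c n *\<^sub>R \<bar>y n\<bar>"
  shows "disjoint_seq x"
  unfolding disjoint_seq_def
proof (intro allI impI)
  fix n m :: nat assume "n \<noteq> m"
  then have "inf \<bar>y n\<bar> \<bar>y m\<bar> = 0" using assms(1) by (simp add: disjoint_seq_def)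
  then have "inf (c n *\<^sub>R \<bar>y n\<bar>) (c m *\<^sub>R \<bar>y m\<bar>) = 0"
    using assms(2) by (intro inf_scaleR_eq_zero) auto
  then show "inf \<bar>x n\<bar> \<bar>x m\<bar> = 0" by (rule inf_eq_zero_mono) (use assms(3) in auto)
qed

lemma disjoint_seq_subseq:
  "disjoint_seq x \<Longrightarrow> strict_mono r \<Longrightarrow> disjoint_seq (x \<circ> r)"
  by (auto simp: disjoint_seq_def strict_mono_eq)

text \<open>A partial sum is disjoint from every later term, so by
  \<open>a + b = inf a b + sup a b\<close> adding that term amounts to taking a supremum, which
  stays below \<open>w\<close>.\<close>

lemma sum_disjoint_le:
  fixes d :: "nat \<Rightarrow> 'a::banach_lattice"
  assumes "disjoint_seq d" "\<And>n. 0 \<le> d n" "\<And>n. d n \<le> w"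
  shows "sum d {..<N} \<le> w"
proof -
  have disj: "inf (sum d {..<N}) (d m) = 0" if "N \<le> m" for N m
    using that
  proof (induction N)
    case 0
    show ?case using assms(2)[of m] by (simp add: inf_absorb1)
  next
    case (Suc N)
    have "inf (sum d {..<N} + d N) (d m) \<le> inf (sum d {..<N}) (d m) + inf (d N) (d m)"
      by (intro inf_add_le_add_inf sum_nonneg assms)
    also have "\<dots> = 0"
    proof -
      have "inf (d N) (d m) = 0"
        using assms(1,2) Suc.prems unfolding disjoint_seq_def by (metis Suc_n_not_le_n abs_of_nonneg)
      then show ?thesis using Suc by simp
    qed
    finally show ?case
      using assms(2) by (simp add: antisym sum_nonneg)
  qed
  show ?thesis
  proof (induction N)
    case 0
    show ?case using order_trans[OF assms(2)[of 0] assms(3)[of 0]] by simp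
  next
    case (Suc N)
    have "sum d {..<Suc N} = sup (sum d {..<N}) (d N)"
      using disj[of N N] add_eq_inf_sup[of "sum d {..<N}" "d N"] by simp
    then show ?case using Suc assms(3) by simp
  qed
qed

text \<open>Since \<open>- l \<le> u n - l\<close>, the negative part of \<open>l\<close> is bounded
  by \<open>\<bar>u n - l\<bar>\<close>, whose norm tends to zero.\<close>

lemma nonneg_if_limit_nonneg:
  fixes u :: "nat \<Rightarrow> 'a::banach_lattice"
  assumes "u \<longlonglongrightarrow> l" "\<And>n. 0 \<le> u n"
  shows "0 \<le> l"
proof -
  have "norm (nprt l) \<le> norm (u n - l)" for n
  proof -
    have "sup (- l) 0 \<le> \<bar>u n - l\<bar>"
      by (rule le_supI) (use assms(2)[of n] abs_ge_self[of "u n - l"] in \<open>auto intro: order_trans[of _ "u n - l"]\<close>)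
    then have "norm (pprt (- l)) \<le> norm \<bar>u n - l\<bar>"
      by (intro norm_mono_nonneg) (auto simp: pprt_def)
    then show ?thesis by (simp add: pprt_neg)
  qed
  moreover have "(\<lambda>n. norm (u n - l)) \<longlonglongrightarrow> 0"
    using assms(1) by (simp add: LIM_zero tendsto_norm_zero)
  ultimately have "norm (nprt l) \<le> 0"
    by (intro LIMSEQ_le_const) auto
  then show ?thesis by (simp add: zero_le_iff_zero_nprt)
qed

section \<open>Lattice seminorms and their localisation to a band\<close>

text \<open>Homogeneity is stated as an inequality, which is easier to verify for suprema; equality
  follows by applying it to \<open>inverse c\<close>.\<close>

definition lattice_seminorm :: "('a::banach_lattice \<Rightarrow> real) \<Rightarrow> bool" where
  "lattice_seminorm p \<longleftrightarrow>
     (\<forall>x y. p (x + y) \<le> p x + p y) \<and> (\<forall>c x. p (c *\<^sub>R x) \<le> \<bar>c\<bar> * p x) \<and>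
     (\<forall>x y. \<bar>x\<bar> \<le> \<bar>y\<bar> \<longrightarrow> p x \<le> p y)"

lemma lattice_seminormD:
  assumes "lattice_seminorm p"
  shows "p (x + y) \<le> p x + p y" "p (c *\<^sub>R x) \<le> \<bar>c\<bar> * p x" "\<bar>x\<bar> \<le> \<bar>y\<bar> \<Longrightarrow> p x \<le> p y"
  using assms by (auto simp: lattice_seminorm_def)

lemma lattice_seminorm_scaleR:
  assumes "lattice_seminorm p"
  shows "p (c *\<^sub>R x) = \<bar>c\<bar> * p x"
proof (cases "c = 0")
  case True
  have "p 0 = 0"
    using lattice_seminormD(2)[OF assms, of 0 0] lattice_seminormD(1)[OF assms, of 0 0] by simp
  with True show ?thesis by simp
next
  case False
  have "p x \<le> \<bar>inverse c\<bar> * p (c *\<^sub>R x)"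
    using lattice_seminormD(2)[OF assms, of "inverse c" "c *\<^sub>R x"] False by simp
  then have "\<bar>c\<bar> * p x \<le> p (c *\<^sub>R x)"
    using False by (simp add: field_simps abs_inverse)
  with lattice_seminormD(2)[OF assms, of c x] show ?thesis by simp
qed

lemma lattice_seminorm_nonneg:
  assumes "lattice_seminorm p"
  shows "0 \<le> p x"
  using lattice_seminormD(1)[OF assms, of x "- x"] lattice_seminorm_scaleR[OF assms, of "-1" x]
    lattice_seminorm_scaleR[OF assms, of 0 x] by simp

lemma lattice_seminorm_sum:
  assumes "lattice_seminorm p"
  shows "p (sum f I) \<le> (\<Sum>i\<in>I. p (f i))"
proof (induction I rule: infinite_finite_induct)
  case (insert i I)
  then show ?case
    using lattice_seminormD(1)[OF assms, of "f i" "sum f I"] by simp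
qed (use lattice_seminorm_scaleR[OF assms, of 0] in auto)

lemma lattice_seminorm_norm: "lattice_seminorm (norm :: 'a::banach_lattice \<Rightarrow> real)"
  by (auto simp: lattice_seminorm_def norm_triangle_ineq norm_mono_abs)

text \<open>If \<open>p\<close> is order continuous, this is \<open>p\<close> of the projection of \<open>x\<close> to the band generated by \<open>y\<close>; a band
  projection need not exist in general.\<close>

definition band_seminorm :: "('a::banach_lattice \<Rightarrow> real) \<Rightarrow> 'a \<Rightarrow> 'a \<Rightarrow> real" where
  "band_seminorm p y x = (SUP k::nat. p (inf \<bar>x\<bar> (real k *\<^sub>R \<bar>y\<bar>)))"

lemma abs_inf_scaleR_abs:
  fixes x y :: "'a::banach_lattice"
  shows "abs (inf \<bar>x\<bar> (real k *\<^sub>R \<bar>y\<bar>)) = inf \<bar>x\<bar> (real k *\<^sub>R \<bar>y\<bar>)"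
  by (auto intro!: abs_of_nonneg scaleR_nonneg_nonneg)

lemma band_seminorm_approx_le:
  assumes "lattice_seminorm p"
  shows "p (inf \<bar>x\<bar> (real k *\<^sub>R \<bar>y\<bar>)) \<le> p x"
  by (rule lattice_seminormD[OF assms]) (simp add: abs_inf_scaleR_abs)

lemma band_seminorm_bdd:
  assumes "lattice_seminorm p"
  shows "bdd_above (range (\<lambda>k. p (inf \<bar>x\<bar> (real k *\<^sub>R \<bar>y\<bar>))))"
  by (intro bdd_aboveI2[of _ _ "p x"] band_seminorm_approx_le assms)

lemma band_seminorm_upper:
  assumes "lattice_seminorm p"
  shows "p (inf \<bar>x\<bar> (real k *\<^sub>R \<bar>y\<bar>)) \<le> band_seminorm p y x"
  unfolding band_seminorm_def by (intro cSUP_upper band_seminorm_bdd assms) simp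

lemma band_seminorm_le:
  assumes "lattice_seminorm p"
  shows "band_seminorm p y x \<le> p x"
  unfolding band_seminorm_def by (intro cSUP_least band_seminorm_approx_le assms) simp

text \<open>The approximants increase with \<open>k\<close>, so the supremum is a limit; finite sums
  of band seminorms can then be estimated for fixed \<open>k\<close> first.\<close>

lemma band_seminorm_LIMSEQ:
  assumes "lattice_seminorm p"
  shows "(\<lambda>k. p (inf \<bar>x\<bar> (real k *\<^sub>R \<bar>y\<bar>))) \<longlonglongrightarrow> band_seminorm p y x"
  unfolding band_seminorm_def
proof (rule LIMSEQ_incseq_SUP[OF band_seminorm_bdd[OF assms]], rule incseq_SucI)
  fix k
  show "p (inf \<bar>x\<bar> (real k *\<^sub>R \<bar>y\<bar>)) \<le> p (inf \<bar>x\<bar> (real (Suc k) *\<^sub>R \<bar>y\<bar>))"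
    by (rule lattice_seminormD[OF assms], unfold abs_inf_scaleR_abs, rule inf_mono)
      (auto intro: scaleR_right_mono)
qed

text \<open>The approximant with \<open>k = 1\<close> already equals \<open>p \<bar>y\<bar>\<close>.
  This is how a bound on the seminorm of \<open>x\<close> controls \<open>y\<close>.\<close>

lemma band_seminorm_ge:
  assumes "lattice_seminorm p" "\<bar>y\<bar> \<le> \<bar>x\<bar>"
  shows "p y \<le> band_seminorm p y x"
proof -
  have "p y \<le> p (inf \<bar>x\<bar> (real 1 *\<^sub>R \<bar>y\<bar>))"
    using assms(2) by (intro lattice_seminormD[OF assms(1)]) (simp add: inf_absorb2)
  then show ?thesis using band_seminorm_upper[OF assms(1), of x 1 y] by linarith
qed

text \<open>Each property is shown for the single approximants, with the seminorm itself on the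
  right-hand side, and then passed to the supremum.\<close>

lemma lattice_seminorm_band_seminorm:
  assumes "lattice_seminorm p"
  shows "lattice_seminorm (band_seminorm p y)"
  unfolding lattice_seminorm_def
proof (intro conjI allI impI)
  fix x z
  have "p (inf \<bar>x + z\<bar> (real k *\<^sub>R \<bar>y\<bar>)) \<le> band_seminorm p y x + band_seminorm p y z" for k
  proof -
    let ?k = "real k *\<^sub>R \<bar>y\<bar>"
    have k: "0 \<le> ?k" by (auto intro: scaleR_nonneg_nonneg)
    have "inf \<bar>x + z\<bar> ?k \<le> inf (\<bar>x\<bar> + \<bar>z\<bar>) ?k"
      by (intro inf_mono abs_triangle_ineq) auto
    also have "\<dots> \<le> inf \<bar>x\<bar> ?k + inf \<bar>z\<bar> ?k"
      by (intro inf_add_le_add_inf k) auto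
    also have "\<dots> = abs (inf \<bar>x\<bar> ?k + inf \<bar>z\<bar> ?k)"
      using k by (simp add: abs_of_nonneg)
    finally have "p (inf \<bar>x + z\<bar> ?k) \<le> p (inf \<bar>x\<bar> ?k + inf \<bar>z\<bar> ?k)"
      by (intro lattice_seminormD(3)[OF assms]) (simp add: abs_inf_scaleR_abs)
    also have "\<dots> \<le> p (inf \<bar>x\<bar> ?k) + p (inf \<bar>z\<bar> ?k)" by (rule lattice_seminormD[OF assms])
    also have "\<dots> \<le> band_seminorm p y x + band_seminorm p y z"
      by (intro add_mono band_seminorm_upper assms)
    finally show ?thesis .
  qed
  then show "band_seminorm p y (x + z) \<le> band_seminorm p y x + band_seminorm p y z"
    unfolding band_seminorm_def[of p y "x + z"] by (intro cSUP_least) auto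
next
  fix c x
  have nn: "0 \<le> band_seminorm p y x"
    using band_seminorm_upper[OF assms, of x 0 y] lattice_seminorm_nonneg[OF assms] order_trans by blast
  have "p (inf \<bar>c *\<^sub>R x\<bar> (real k *\<^sub>R \<bar>y\<bar>)) \<le> \<bar>c\<bar> * band_seminorm p y x" for k
  proof (cases "c = 0")
    case True
    have "inf 0 (real k *\<^sub>R \<bar>y\<bar>) = 0"
      by (intro inf_absorb1 scaleR_nonneg_nonneg) auto
    then show ?thesis using lattice_seminorm_scaleR[OF assms, of 0] True by simp
  next
    case False
    \<comment> \<open>Pulling out \<open>\<bar>c\<bar>\<close> turns the multiple \<open>k\<close>
      into \<open>k / \<bar>c\<bar>\<close>, which need not be a natural number and is rounded up to
      \<open>m\<close>.\<close>
    obtain m :: nat where m: "real k / \<bar>c\<bar> \<le> real m" using real_arch_simple by blast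
    have "inf \<bar>c *\<^sub>R x\<bar> (real k *\<^sub>R \<bar>y\<bar>) = \<bar>c\<bar> *\<^sub>R inf \<bar>x\<bar> ((real k / \<bar>c\<bar>) *\<^sub>R \<bar>y\<bar>)"
      using False by (simp add: abs_scaleR flip: inf_scaleR_nonneg)
    also have "p \<dots> = \<bar>c\<bar> * p (inf \<bar>x\<bar> ((real k / \<bar>c\<bar>) *\<^sub>R \<bar>y\<bar>))"
      by (simp add: lattice_seminorm_scaleR[OF assms])
    also have "p (inf \<bar>x\<bar> ((real k / \<bar>c\<bar>) *\<^sub>R \<bar>y\<bar>)) \<le> p (inf \<bar>x\<bar> (real m *\<^sub>R \<bar>y\<bar>))"
    proof (rule lattice_seminormD[OF assms])
      have "inf \<bar>x\<bar> ((real k / \<bar>c\<bar>) *\<^sub>R \<bar>y\<bar>) \<le> inf \<bar>x\<bar> (real m *\<^sub>R \<bar>y\<bar>)"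
        by (rule inf_mono) (use m in \<open>auto intro: scaleR_right_mono\<close>)
      moreover have "0 \<le> inf \<bar>x\<bar> ((real k / \<bar>c\<bar>) *\<^sub>R \<bar>y\<bar>)"
        by (intro le_infI scaleR_nonneg_nonneg) auto
      ultimately show "abs (inf \<bar>x\<bar> ((real k / \<bar>c\<bar>) *\<^sub>R \<bar>y\<bar>)) \<le> abs (inf \<bar>x\<bar> (real m *\<^sub>R \<bar>y\<bar>))"
        by (simp only: abs_inf_scaleR_abs abs_of_nonneg)
    qed
    also have "\<dots> \<le> band_seminorm p y x" by (rule band_seminorm_upper[OF assms])
    finally show ?thesis by (simp add: mult_left_mono)
  qed
  then show "band_seminorm p y (c *\<^sub>R x) \<le> \<bar>c\<bar> * band_seminorm p y x"
    unfolding band_seminorm_def[of p y "c *\<^sub>R x"] by (intro cSUP_least) auto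
next
  fix x z :: 'a assume xz: "\<bar>x\<bar> \<le> \<bar>z\<bar>"
  have "p (inf \<bar>x\<bar> (real k *\<^sub>R \<bar>y\<bar>)) \<le> band_seminorm p y z" for k
  proof -
    have "p (inf \<bar>x\<bar> (real k *\<^sub>R \<bar>y\<bar>)) \<le> p (inf \<bar>z\<bar> (real k *\<^sub>R \<bar>y\<bar>))"
      by (rule lattice_seminormD[OF assms], unfold abs_inf_scaleR_abs, rule inf_mono) (use xz in auto)
    then show ?thesis using band_seminorm_upper[OF assms, of z k y] by linarith
  qed
  then show "band_seminorm p y x \<le> band_seminorm p y z"
    unfolding band_seminorm_def[of p y x] by (intro cSUP_least) auto
qed

subsection \<open>Hahn-Banach and dominating positive functionals\<close>

definition sublinear :: "('a::real_vector \<Rightarrow> real) \<Rightarrow> bool" where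
  "sublinear p \<longleftrightarrow> (\<forall>x y. p (x + y) \<le> p x + p y) \<and> (\<forall>c\<ge>0. \<forall>x. p (c *\<^sub>R x) = c * p x)"

lemma sublinearD:
  assumes "sublinear p"
  shows "p (x + y) \<le> p x + p y" "0 \<le> c \<Longrightarrow> p (c *\<^sub>R x) = c * p x"
  using assms by (auto simp: sublinear_def)

lemma sublinear_zero: "sublinear p \<Longrightarrow> p 0 = 0"
  using sublinearD(2)[of p 0 0] by simp

lemma sublinearI:
  assumes "\<And>x y. p (x + y) \<le> p x + p y" "p 0 = 0" "\<And>c x. 0 < c \<Longrightarrow> p (c *\<^sub>R x) \<le> c * p x"
  shows "sublinear p"
  unfolding sublinear_def
proof (intro conjI allI impI assms(1))
  fix c :: real and x assume "0 \<le> c"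
  show "p (c *\<^sub>R x) = c * p x"
  proof (cases "c = 0")
    case False
    with \<open>0 \<le> c\<close> have c: "0 < c" by simp
    have "p x \<le> inverse c * p (c *\<^sub>R x)"
      using assms(3)[of "inverse c" "c *\<^sub>R x"] c by simp
    then have "c * p x \<le> p (c *\<^sub>R x)" using c by (simp add: field_simps)
    with assms(3)[OF c, of x] show ?thesis by simp
  qed (simp add: assms(2))
qed

lemma sublinear_lower_bound: "sublinear p \<Longrightarrow> - p (- x) \<le> p x"
  using sublinearD(1)[of p x "- x"] sublinear_zero[of p] by simp

text \<open>The witness is the infimum of \<open>p (y + t *\<^sub>R x) - t * p x\<close> over
  \<open>t \<ge> 0\<close>; \<open>t = 0\<close> and \<open>t = 1\<close> give the two bounds. The
  lemma serves twice: it makes minimal sublinear functionals additive, and it prescribes the value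
  at a point in the Hahn-Banach theorem.\<close>

lemma sublinear_shift:
  assumes p: "sublinear p"
  obtains q where "sublinear q" "\<And>y. q y \<le> p y" "\<And>y. q y \<le> p (y + x) - p x"
proof
  define q where "q y = (INF t\<in>{0..}. p (y + t *\<^sub>R x) - t * p x)" for y
  \<comment> \<open>A lower bound independent of \<open>t\<close> makes the infimum a genuine one in
    the reals.\<close>
  have "- p (- y) \<le> p (y + t *\<^sub>R x) - t * p x" if "0 \<le> t" for y t
    using sublinearD(1)[OF p, of "y + t *\<^sub>R x" "- y"] sublinearD(2)[OF p that, of x] by simp
  then have bdd: "bdd_below ((\<lambda>t. p (y + t *\<^sub>R x) - t * p x) ` {0..})" for y
    by (intro bdd_belowI2[of _ "- p (- y)"]) auto
  have low: "q y \<le> p (y + t *\<^sub>R x) - t * p x" if "0 \<le> t" for y t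
    unfolding q_def using that by (intro cINF_lower bdd) simp
  show "q y \<le> p y" for y using low[of 0 y] by simp
  show "q y \<le> p (y + x) - p x" for y using low[of 1 y] by simp
  show "sublinear q"
  proof (rule sublinearI)
    fix y z
    have 1: "q (y + z) \<le> (p (y + s *\<^sub>R x) - s * p x) + (p (z + t *\<^sub>R x) - t * p x)"
      if "0 \<le> s" "0 \<le> t" for s t
      using low[of "s + t" "y + z"] sublinearD(1)[OF p, of "y + s *\<^sub>R x" "z + t *\<^sub>R x"] that
      by (simp add: algebra_simps)
    have "q (y + z) - (p (z + t *\<^sub>R x) - t * p x) \<le> q y" if "0 \<le> t" for t
      unfolding q_def[of y] using 1[OF _ that] by (intro cINF_greatest) (auto simp: algebra_simps)
    then have "q (y + z) - q y \<le> q z"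
      unfolding q_def[of z] by (intro cINF_greatest) (auto simp: algebra_simps)
    then show "q (y + z) \<le> q y + q z" by simp
  next
    have "p (t *\<^sub>R x) - t * p x = 0" if "0 \<le> t" for t
      using sublinearD(2)[OF p that] by simp
    then have "q 0 = (INF t\<in>{0..}::real set. 0)"
      unfolding q_def by (intro INF_cong) auto
    then show "q 0 = 0" by simp
  next
    fix c :: real and y assume c: "0 < c"
    have "q (c *\<^sub>R y) / c \<le> p (y + t *\<^sub>R x) - t * p x" if "0 \<le> t" for t
    proof -
      have "q (c *\<^sub>R y) \<le> p (c *\<^sub>R (y + t *\<^sub>R x)) - (c * t) * p x"
        using low[of "c * t" "c *\<^sub>R y"] that c by (simp add: scaleR_add_right)
      also have "\<dots> = c * (p (y + t *\<^sub>R x) - t * p x)"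
        using c by (simp add: sublinearD(2)[OF p] right_diff_distrib)
      finally show ?thesis using c by (simp add: field_simps)
    qed
    then have "q (c *\<^sub>R y) / c \<le> q y"
      unfolding q_def[of y] by (intro cINF_greatest) auto
    then show "q (c *\<^sub>R y) \<le> c * q y" using c by (simp add: field_simps)
  qed
qed

text \<open>The bound \<open>- p (- x)\<close> keeps the infima finite. Subadditivity uses the chain
  property: of two members \<open>q\<close> and \<open>r\<close>, the smaller one serves for both
  summands at once.\<close>

lemma sublinear_INF_chain:
  assumes C: "C \<noteq> {}" "\<And>q. q \<in> C \<Longrightarrow> sublinear q" "\<And>q. q \<in> C \<Longrightarrow> q \<le> p"
    and chain: "\<And>q r. q \<in> C \<Longrightarrow> r \<in> C \<Longrightarrow> q \<le> r \<or> r \<le> q"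
  shows "sublinear (\<lambda>x. INF q\<in>C. q x)" "\<And>q. q \<in> C \<Longrightarrow> (\<lambda>x. INF q\<in>C. q x) \<le> q"
proof -
  have "- p (- x) \<le> q x" if "q \<in> C" for q x
    using sublinear_lower_bound[OF C(2)[OF that], of x] le_funD[OF C(3)[OF that], of "- x"] by simp
  then have bdd: "bdd_below ((\<lambda>q. q x) ` C)" for x
    by (intro bdd_belowI2[of _ "- p (- x)"]) auto
  have low: "(INF q\<in>C. q x) \<le> q x" if "q \<in> C" for q x
    using that by (intro cINF_lower bdd)
  show "\<And>q. q \<in> C \<Longrightarrow> (\<lambda>x. INF q\<in>C. q x) \<le> q" using low by (simp add: le_fun_def)
  show "sublinear (\<lambda>x. INF q\<in>C. q x)"
  proof (rule sublinearI)
    fix x y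
    have 1: "(INF q\<in>C. q (x + y)) \<le> q x + r y" if "q \<in> C" "r \<in> C" for q r
    proof -
      obtain s where s: "s \<in> C" "s \<le> q" "s \<le> r"
        using chain[of q r] \<open>q \<in> C\<close> \<open>r \<in> C\<close> by blast
      show ?thesis
        using low[OF s(1), of "x + y"] sublinearD(1)[OF C(2)[OF s(1)], of x y]
          le_funD[OF s(2), of x] le_funD[OF s(3), of y] by linarith
    qed
    have "(INF q\<in>C. q (x + y)) - r y \<le> (INF q\<in>C. q x)" if "r \<in> C" for r
      using 1[OF _ that] C(1) by (intro cINF_greatest) (auto simp: algebra_simps)
    then have "(INF q\<in>C. q (x + y)) - (INF q\<in>C. q x) \<le> (INF q\<in>C. q y)"
      using C(1) by (intro cINF_greatest) (auto simp: algebra_simps)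
    then show "(INF q\<in>C. q (x + y)) \<le> (INF q\<in>C. q x) + (INF q\<in>C. q y)" by simp
  next
    have "(INF q\<in>C. q 0) = (INF q\<in>C. 0)"
      by (intro INF_cong) (auto simp: sublinear_zero C(2))
    then show "(INF q\<in>C. q 0) = 0" using C(1) by simp
  next
    fix c :: real and x assume c: "0 < c"
    have "(INF q\<in>C. q (c *\<^sub>R x)) / c \<le> q x" if "q \<in> C" for q
      using low[OF that, of "c *\<^sub>R x"] sublinearD(2)[OF C(2)[OF that], of c x] c
      by (simp add: field_simps)
    then have "(INF q\<in>C. q (c *\<^sub>R x)) / c \<le> (INF q\<in>C. q x)"
      using C(1) by (intro cINF_greatest) auto
    then show "(INF q\<in>C. q (c *\<^sub>R x)) \<le> c * (INF q\<in>C. q x)" using c by (simp add: field_simps)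
  qed
qed

text \<open>By minimality \<open>q\<close> coincides with its shift in every direction
  \<open>x\<close>, and the second bound of the shift is then superadditivity.\<close>

lemma minimal_sublinear_linear:
  assumes q: "sublinear q" and min: "\<And>r. sublinear r \<Longrightarrow> r \<le> q \<Longrightarrow> r = q"
  shows "linear q"
proof -
  have add: "q (x + y) = q x + q y" for x y
  proof (rule antisym)
    obtain r where "sublinear r" "\<And>y. r y \<le> q y" and r: "\<And>y. r y \<le> q (y + x) - q x"
      using sublinear_shift[OF q] by metis
    then have "r = q" by (intro min) (auto simp: le_fun_def)
    with r[of y] show "q x + q y \<le> q (x + y)" by (simp add: add.commute)
  qed (rule sublinearD[OF q])
  have minus: "q (- x) = - q x" for x
    using add[of x "- x"] sublinear_zero[OF q] by simp
  show ?thesis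
  proof (rule linearI[OF add])
    fix c :: real and x
    show "q (c *\<^sub>R x) = c *\<^sub>R q x"
    proof (cases "0 \<le> c")
      case False
      then have "q (- ((- c) *\<^sub>R x)) = - ((- c) * q x)"
        unfolding minus by (subst sublinearD(2)[OF q]) auto
      then show ?thesis by simp
    qed (simp add: sublinearD(2)[OF q])
  qed
qed

text \<open>Zorn's lemma for the reversed pointwise order yields a minimal sublinear functional
  below \<open>p\<close>, which is linear. The empty chain is bounded by \<open>p\<close>
  itself.\<close>

lemma sublinear_dominates_linear:
  assumes p: "sublinear p"
  obtains f where "linear f" "\<And>x. f x \<le> p x"
proof -
  let ?A = "{q. sublinear q \<and> q \<le> p}"
  have "\<exists>m\<in>?A. \<forall>q\<in>?A. q \<le> m \<longrightarrow> q = m"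
  proof (rule predicate_Zorn)
    show "partial_order_on ?A (relation_of (\<lambda>q r. r \<le> q) ?A)"
      by (rule partial_order_on_relation_ofI) auto
  next
    fix C assume C: "C \<in> Chains (relation_of (\<lambda>q r. r \<le> q) ?A)"
    show "\<exists>u\<in>?A. \<forall>a\<in>C. u \<le> a"
    proof (cases "C = {}")
      case True
      then show ?thesis using p by auto
    next
      case False
      have mem: "sublinear q" "q \<le> p" if "q \<in> C" for q
        using C that by (auto simp: Chains_def relation_of_def)
      have ch: "q \<le> r \<or> r \<le> q" if "q \<in> C" "r \<in> C" for q r
        using C that by (auto simp: Chains_def relation_of_def)
      note inf = sublinear_INF_chain[OF False mem(1) mem(2) ch]
      obtain q where "q \<in> C" using False by blast
      then have "(\<lambda>x. INF q\<in>C. q x) \<le> p"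
        using inf(2) mem(2) order_trans by metis
      with inf show ?thesis by blast
    qed
  qed
  then obtain m where m: "sublinear m" "m \<le> p" "\<And>q. sublinear q \<Longrightarrow> q \<le> p \<Longrightarrow> q \<le> m \<Longrightarrow> q = m"
    by blast
  have "linear m"
    by (rule minimal_sublinear_linear[OF m(1)]) (use m(2,3) order_trans in blast)
  then show ?thesis using that m(2) by (auto simp: le_fun_def)
qed

lemma hahn_banach_seminorm:
  fixes p :: "'a::real_normed_vector \<Rightarrow> real"
  assumes add: "\<And>x y. p (x + y) \<le> p x + p y" and scale: "\<And>c x. p (c *\<^sub>R x) = \<bar>c\<bar> * p x"
    and bound: "\<And>x. p x \<le> C * norm x"
  obtains f :: "'a \<Rightarrow>\<^sub>L real" where "\<And>x. \<bar>blinfun_apply f x\<bar> \<le> p x" "blinfun_apply f x\<^sub>0 = p x\<^sub>0"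
proof -
  have p: "sublinear p" by (simp add: sublinear_def add scale)
  obtain q where q: "sublinear q" "\<And>y. q y \<le> p y" "\<And>y. q y \<le> p (y + x\<^sub>0) - p x\<^sub>0"
    using sublinear_shift[OF p] by metis
  obtain f where f: "linear f" "\<And>x. f x \<le> q x" using sublinear_dominates_linear[OF q(1)] by blast
  have fp: "\<bar>f x\<bar> \<le> p x" for x
    using f(2)[of x] q(2)[of x] f(2)[of "- x"] q(2)[of "- x"] scale[of "-1" x] linear_neg[OF f(1), of x]
    by (simp add: abs_le_iff)
  \<comment> \<open>The shift gives \<open>q (- x\<^sub>0) \<le> p 0 - p x\<^sub>0\<close>, and
    \<open>f\<close> lies below \<open>q\<close>.\<close>
  have "p x\<^sub>0 \<le> f x\<^sub>0"
    using f(2)[of "- x\<^sub>0"] q(3)[of "- x\<^sub>0"] linear_neg[OF f(1), of x\<^sub>0] scale[of 0 0] by simp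
  then have eq: "f x\<^sub>0 = p x\<^sub>0" using fp[of x\<^sub>0] by linarith
  have "bounded_linear f"
    using f(1) fp bound by (intro bounded_linear_intro[of f C])
      (auto simp: linear_add linear_scale mult.commute intro: order_trans)
  then have "blinfun_apply (Blinfun f) = f" by (rule bounded_linear_Blinfun_apply)
  with that[of "Blinfun f"] fp eq show ?thesis by simp
qed

section \<open>The modulus of a bounded functional\<close>

text \<open>The functional \<open>g\<close> is the modulus of \<open>f\<close>, given on the
  positive cone by the Riesz-Kantorovich formula \<open>\<rho>\<close>. Riesz decomposition makes
  \<open>\<rho>\<close> additive there, and \<open>g\<close> extends it to differences of positive
  elements.\<close>

lemma positive_functional_dominating:
  fixes f :: "'a::banach_lattice \<Rightarrow>\<^sub>L real"
  obtains g :: "'a \<Rightarrow>\<^sub>L real" where "op_le 0 g" "\<And>x. \<bar>blinfun_apply f x\<bar> \<le> blinfun_apply g \<bar>x\<bar>"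
proof -
  define \<rho> where "\<rho> x = (SUP z\<in>{z. \<bar>z\<bar> \<le> x}. blinfun_apply f z)" for x
  have fz: "blinfun_apply f z \<le> norm f * norm x" if "\<bar>z\<bar> \<le> x" for x z
  proof -
    have "blinfun_apply f z \<le> norm f * norm z" using norm_blinfun[of f z] by simp
    also have "norm z \<le> norm x" using that abs_ge_self order_trans by (intro norm_mono_abs) blast
    finally show ?thesis by (simp add: mult_left_mono)
  qed
  then have bdd: "bdd_above (blinfun_apply f ` {z. \<bar>z\<bar> \<le> x})" for x
    by (intro bdd_aboveI2[of _ _ "norm f * norm x"]) auto
  have up: "blinfun_apply f z \<le> \<rho> x" if "\<bar>z\<bar> \<le> x" for z x
    unfolding \<rho>_def using that by (intro cSUP_upper bdd) simp
  have ne: "{z. \<bar>z\<bar> \<le> x} \<noteq> {}" if "0 \<le> x" for x :: 'a using that by (auto intro: exI[of _ 0])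
  have nonneg: "0 \<le> \<rho> x" if "0 \<le> x" for x using up[of 0 x] that by (simp add: blinfun.zero_right)
  have norm_le: "\<rho> x \<le> norm f * norm x" if "0 \<le> x" for x
    unfolding \<rho>_def using fz by (intro cSUP_least ne that) auto
  have add: "\<rho> (x + y) = \<rho> x + \<rho> y" if xy: "0 \<le> x" "0 \<le> y" for x y
  proof (rule antisym)
    show "\<rho> (x + y) \<le> \<rho> x + \<rho> y"
      unfolding \<rho>_def[of "x + y"]
    proof (rule cSUP_least)
      show "{z. \<bar>z\<bar> \<le> x + y} \<noteq> {}" by (intro ne add_nonneg_nonneg xy)
      fix z assume "z \<in> {z. \<bar>z\<bar> \<le> x + y}"
      then obtain u v where "z = u + v" "\<bar>u\<bar> \<le> x" "\<bar>v\<bar> \<le> y" using riesz_decomposition[OF xy] by blast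
      then show "blinfun_apply f z \<le> \<rho> x + \<rho> y"
        using up by (auto simp: blinfun.add_right intro: add_mono)
    qed
    have 1: "blinfun_apply f u + blinfun_apply f v \<le> \<rho> (x + y)" if "\<bar>u\<bar> \<le> x" "\<bar>v\<bar> \<le> y" for u v
      using up[of "u + v" "x + y"] order_trans[OF abs_triangle_ineq add_mono[OF that]]
      by (simp add: blinfun.add_right)
    have "\<rho> x \<le> \<rho> (x + y) - blinfun_apply f v" if "\<bar>v\<bar> \<le> y" for v
      unfolding \<rho>_def[of x] using 1[OF _ that] by (intro cSUP_least ne xy) (auto simp: algebra_simps)
    then have "\<rho> y \<le> \<rho> (x + y) - \<rho> x"
      unfolding \<rho>_def[of y] by (intro cSUP_least ne xy) (auto simp: algebra_simps)
    then show "\<rho> x + \<rho> y \<le> \<rho> (x + y)" by simp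
  qed
  have scale_le: "\<rho> (c *\<^sub>R x) \<le> c * \<rho> x" if "0 < c" "0 \<le> x" for c x
    unfolding \<rho>_def[of "c *\<^sub>R x"]
  proof (rule cSUP_least)
    show "{z. \<bar>z\<bar> \<le> c *\<^sub>R x} \<noteq> {}" using that by (intro ne scaleR_nonneg_nonneg) auto
    fix z assume "z \<in> {z. \<bar>z\<bar> \<le> c *\<^sub>R x}"
    then have "\<bar>inverse c *\<^sub>R z\<bar> \<le> x"
      using that scaleR_left_mono[of "\<bar>z\<bar>" "c *\<^sub>R x" "inverse c"] by (simp add: abs_scaleR)
    from up[OF this] show "blinfun_apply f z \<le> c * \<rho> x"
      using that by (simp add: blinfun.scaleR_right field_simps)
  qed
  have scale: "\<rho> (c *\<^sub>R x) = c * \<rho> x" if "0 < c" "0 \<le> x" for c x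
  proof -
    have "\<rho> x \<le> inverse c * \<rho> (c *\<^sub>R x)"
      using scale_le[of "inverse c" "c *\<^sub>R x"] that by (simp add: scaleR_nonneg_nonneg)
    then have "c * \<rho> x \<le> \<rho> (c *\<^sub>R x)" using that by (simp add: field_simps)
    with scale_le[OF that] show ?thesis by simp
  qed
  define g where "g x = \<rho> (pprt x) - \<rho> (pprt (- x))" for x
  \<comment> \<open>The value of \<open>g\<close> does not depend on how its argument is written as
    a difference of positive elements; linearity then reduces to the cone.\<close>
  have g_diff: "g (a - b) = \<rho> a - \<rho> b" if "0 \<le> a" "0 \<le> b" for a b
  proof -
    have "pprt (a - b) - pprt (- (a - b)) = a - b"
      using prts[of "a - b"] by (simp add: pprt_neg del: minus_diff_eq)
    \<comment> \<open>Rearranged so that both sides are sums of positive elements, to which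
      additivity of \<open>\<rho>\<close> applies.\<close>
    then have "pprt (a - b) + b = a + pprt (- (a - b))" by (simp add: algebra_simps)
    then have "\<rho> (pprt (a - b) + b) = \<rho> (a + pprt (- (a - b)))" by simp
    then show ?thesis using that by (simp add: g_def add)
  qed
  have g_prts: "x = pprt x - pprt (- x)" for x :: 'a
    using prts[of x] by (simp add: pprt_neg)
  have g_le: "g x \<le> norm f * norm x" for x
  proof -
    have "g x \<le> \<rho> (pprt x)" using nonneg[of "pprt (- x)"] by (simp add: g_def)
    also have "\<dots> \<le> norm f * norm (pprt x)" by (intro norm_le) simp
    also have "norm (pprt x) \<le> norm x"
      by (rule norm_mono_abs) (simp add: pprt_def abs_of_nonneg abs_ge_self)
    finally show ?thesis by (simp add: mult_left_mono)
  qed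
  have g_minus: "g (- x) = - g x" for x by (simp add: g_def)
  have lin: "bounded_linear g"
  proof (rule bounded_linear_intro)
    fix x y :: 'a
    have "x + y = (pprt x - pprt (- x)) + (pprt y - pprt (- y))"
      using g_prts by metis
    also have "\<dots> = (pprt x + pprt y) - (pprt (- x) + pprt (- y))" by simp
    finally have "x + y = (pprt x + pprt y) - (pprt (- x) + pprt (- y))" .
    then have "g (x + y) = g ((pprt x + pprt y) - (pprt (- x) + pprt (- y)))" by simp
    also have "\<dots> = g x + g y" by (subst g_diff) (auto simp: add g_def)
    finally show "g (x + y) = g x + g y" .
  next
    have pos: "g (c *\<^sub>R x) = c * g x" if "0 < c" for c and x :: 'a
    proof -
      have "c *\<^sub>R x = c *\<^sub>R pprt x - c *\<^sub>R pprt (- x)"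
        using arg_cong[OF g_prts[of x], of "\<lambda>y. c *\<^sub>R y"] by (simp add: scaleR_diff_right)
      then have "g (c *\<^sub>R x) = g (c *\<^sub>R pprt x - c *\<^sub>R pprt (- x))" by simp
      also have "\<dots> = c * g x"
        using that by (subst g_diff) (auto simp: scale g_def scaleR_nonneg_nonneg algebra_simps)
      finally show ?thesis .
    qed
    fix c :: real and x :: 'a
    consider "0 < c" | "c = 0" | "c < 0" by linarith
    then show "g (c *\<^sub>R x) = c *\<^sub>R g x"
    proof cases
      case 1
      then show ?thesis by (simp add: pos)
    next
      case 2
      then show ?thesis by (simp add: g_def)
    next
      case 3
      then have "g (- ((- c) *\<^sub>R x)) = - ((- c) * g x)" unfolding g_minus by (subst pos) auto
      then show ?thesis by simp
    qed
  next
    show "norm (g x) \<le> norm x * norm f" for x :: 'a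
      using g_le[of x] g_le[of "- x"] by (simp add: g_minus mult.commute)
  qed
  have g_nonneg: "g x = \<rho> x" if "0 \<le> x" for x using g_diff[OF that, of 0] nonneg[of 0] norm_le[of 0] by simp
  have "op_le 0 (Blinfun g)"
    using lin nonneg g_nonneg by (auto simp: op_le_def bounded_linear_Blinfun_apply)
  moreover have "\<bar>blinfun_apply f x\<bar> \<le> blinfun_apply (Blinfun g) \<bar>x\<bar>" for x
    using lin up[of x "\<bar>x\<bar>"] up[of "- x" "\<bar>x\<bar>"]
    by (simp add: bounded_linear_Blinfun_apply g_nonneg blinfun.minus_right)
  ultimately show ?thesis by (rule that)
qed

subsection \<open>Weak compactness\<close>

lemma tendsto_fun_iff:
  fixes g :: "'b \<Rightarrow> 'i \<Rightarrow> 'c::topological_space"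
  shows "(g \<longlongrightarrow> l) F \<longleftrightarrow> (\<forall>i. ((\<lambda>n. g n i) \<longlongrightarrow> l i) F)"
  using limitin_componentwise[of "\<lambda>_::'i. euclidean :: 'c topology" UNIV g l F]
  by (simp add: euclidean_product_topology)

lemma topspace_weak_topology [simp]: "topspace weak_topology = UNIV"
  by (simp add: weak_topology_def topspace_pullback_topology)

lemma continuous_map_weak_topology:
  "continuous_map weak_topology euclidean (\<lambda>x (f :: 'a::real_normed_vector \<Rightarrow>\<^sub>L real). blinfun_apply f x)"
  using continuous_map_pullback[of euclidean euclidean id UNIV "\<lambda>x (f :: 'a \<Rightarrow>\<^sub>L real). blinfun_apply f x"]
  by (simp add: weak_topology_def comp_def)

text \<open>Transfers weak compactness to compactness in the product space of functions on the dual,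
  where filters and coordinate projections are available.\<close>

lemma relatively_weakly_compact_evaluation:
  assumes "relatively_weakly_compact A"
  obtains K where "A \<subseteq> K" "compact ((\<lambda>x (f :: 'a::real_normed_vector \<Rightarrow>\<^sub>L real). blinfun_apply f x) ` K)"
proof
  let ?K = "weak_topology closure_of A"
  show "A \<subseteq> ?K" by (rule closure_of_subset) simp
  show "compact ((\<lambda>x (f :: 'a \<Rightarrow>\<^sub>L real). blinfun_apply f x) ` ?K)"
    using image_compactin[OF _ continuous_map_weak_topology] assms
    by (simp add: relatively_weakly_compact_def)
qed

text \<open>The filter \<open>G\<close> takes the place of a weakly convergent subsequence: it
  consists of the tails of the index set intersected with the indices whose terms lie in a weak
  neighbourhood of the cluster point \<open>y\<close>.\<close>

lemma relatively_weakly_compact_cluster_point: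
  fixes A :: "'a::real_normed_vector set"
  assumes "relatively_weakly_compact A" "\<And>n. a n \<in> A"
  obtains y G where "G \<noteq> bot" "G \<le> sequentially"
    "\<And>f :: 'a \<Rightarrow>\<^sub>L real. ((\<lambda>n::nat. blinfun_apply f (a n)) \<longlongrightarrow> blinfun_apply f y) G"
proof -
  let ?e = "\<lambda>x (f :: 'a \<Rightarrow>\<^sub>L real). blinfun_apply f x"
  obtain K where K: "A \<subseteq> K" "compact (?e ` K)"
    using relatively_weakly_compact_evaluation[OF assms(1)] .
  define F where "F = filtermap (\<lambda>n. ?e (a n)) sequentially"
  have aK: "a n \<in> K" for n using K(1) assms(2) by blast
  have "F \<noteq> bot" by (simp add: F_def filtermap_bot_iff)
  moreover have "eventually (\<lambda>\<phi>. \<phi> \<in> ?e ` K) F"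
    unfolding F_def eventually_filtermap by (intro always_eventually allI imageI aK)
  ultimately obtain \<phi> where "\<phi> \<in> ?e ` K" "inf (nhds \<phi>) F \<noteq> bot"
    using K(2) unfolding compact_filter by blast
  then obtain y where y: "inf (nhds (?e y)) F \<noteq> bot" by blast
  define G where "G = inf sequentially (filtercomap (\<lambda>n. ?e (a n)) (nhds (?e y)))"
  \<comment> \<open>If \<open>G\<close> were trivial, the sequence would eventually avoid some weak
    neighbourhood of \<open>y\<close>, which then would not be a cluster point.\<close>
  have "G \<noteq> bot"
  proof
    assume "G = bot"
    then obtain P Q where PQ: "eventually P sequentially"
        "eventually Q (filtercomap (\<lambda>n. ?e (a n)) (nhds (?e y)))" "\<And>n. \<not> (P n \<and> Q n)"
      unfolding G_def trivial_limit_def eventually_inf by blast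
    then obtain R where R: "eventually R (nhds (?e y))" "\<And>n. R (?e (a n)) \<Longrightarrow> Q n"
      unfolding eventually_filtercomap by blast
    have "eventually (\<lambda>\<phi>. \<not> R \<phi>) F"
      using PQ(1) unfolding F_def eventually_filtermap by eventually_elim (use PQ(3) R(2) in blast)
    with R(1) have "eventually (\<lambda>_. False) (inf (nhds (?e y)) F)"
      unfolding eventually_inf by blast
    with y show False by (simp add: trivial_limit_def)
  qed
  moreover have "G \<le> sequentially" by (simp add: G_def)
  moreover have "((\<lambda>n. blinfun_apply f (a n)) \<longlongrightarrow> blinfun_apply f y) G" for f :: "'a \<Rightarrow>\<^sub>L real"
  proof -
    have "((\<lambda>n. ?e (a n)) \<longlongrightarrow> ?e y) G"
      unfolding G_def by (rule filterlim_mono[OF filterlim_filtercomap order_refl]) simp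
    then show ?thesis by (simp add: tendsto_fun_iff)
  qed
  ultimately show ?thesis by (rule that)
qed

lemma norm_attaining_functional:
  fixes x :: "'a::real_normed_vector"
  obtains f :: "'a \<Rightarrow>\<^sub>L real" where "\<And>y. \<bar>blinfun_apply f y\<bar> \<le> norm y" "blinfun_apply f x = norm x"
  by (rule hahn_banach_seminorm[of norm 1 x thesis]) (auto simp: norm_triangle_ineq)

text \<open>Each functional is bounded on \<open>A\<close> by compactness, and the uniform
  boundedness principle does the rest. The Baire argument runs in the dual, which is
  complete.\<close>

lemma relatively_weakly_compact_imp_bounded:
  fixes A :: "'a::real_normed_vector set"
  assumes "relatively_weakly_compact A"
  shows "bounded A"
proof -
  let ?e = "\<lambda>x (f :: 'a \<Rightarrow>\<^sub>L real). blinfun_apply f x"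
  obtain K where K: "A \<subseteq> K" "compact (?e ` K)"
    using relatively_weakly_compact_evaluation[OF assms] .
  have weakly_bounded: "\<exists>n::nat. \<forall>a\<in>A. \<bar>blinfun_apply f a\<bar> \<le> n" for f :: "'a \<Rightarrow>\<^sub>L real"
  proof -
    have "compact ((\<lambda>\<phi>. \<phi> f) ` ?e ` K)"
      by (rule compact_continuous_image[OF continuous_on_subset[OF continuous_on_product_coordinates] K(2)]) simp
    then obtain B where "\<forall>a\<in>K. \<bar>blinfun_apply f a\<bar> \<le> B"
      by (auto dest!: compact_imp_bounded simp: bounded_iff)
    moreover obtain n :: nat where "B \<le> n" using real_arch_simple by blast
    ultimately show ?thesis using K(1) by (meson order_trans subsetD)
  qed
  define D where "D n = (\<Inter>a\<in>A. {f :: 'a \<Rightarrow>\<^sub>L real. \<bar>blinfun_apply f a\<bar> \<le> real n})" for n :: nat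
  have closed: "closed (D n)" for n
    unfolding D_def by (intro closed_INT ballI closed_Collect_le continuous_intros)
  have "(\<Union>n. D n) = UNIV" using weakly_bounded by (auto simp: D_def)
  then have "euclidean interior_of (\<Union>(range D)) \<noteq> {}" by simp
  then obtain n where "interior (D n) \<noteq> {}"
    using Baire_category_alt[of "euclidean :: ('a \<Rightarrow>\<^sub>L real) topology" "range D"]
      closed completely_metrizable_space_euclidean by auto
  then obtain f r where r: "0 < r" "cball f r \<subseteq> D n"
    by (meson equals0I mem_interior_cball)
  have "norm a \<le> 2 * real n / r" if "a \<in> A" for a
  proof -
    obtain h where h: "\<And>y. \<bar>blinfun_apply h y\<bar> \<le> norm y" "blinfun_apply h a = norm a"
      using norm_attaining_functional[of a] by blast
    have "norm h \<le> 1" using h(1) by (intro norm_blinfun_bound) auto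
    \<comment> \<open>The values of these two functionals at \<open>a\<close> differ by
      \<open>r * norm a\<close> and are both at most \<open>n\<close> in absolute value.\<close>
    then have "f + r *\<^sub>R h \<in> D n" "f \<in> D n"
      using r by (auto simp: dist_norm intro!: subsetD[OF r(2)])
    then have "\<bar>blinfun_apply f a + r * norm a\<bar> \<le> real n" "\<bar>blinfun_apply f a\<bar> \<le> real n"
      using that h(2) by (auto simp: D_def blinfun.add_left blinfun.scaleR_left)
    then have "r * norm a \<le> 2 * real n" by linarith
    then show ?thesis using r(1) by (simp add: field_simps)
  qed
  then show ?thesis by (auto simp: bounded_iff)
qed

text \<open>Functionals separate points by Hahn-Banach, so evaluation embeds the space injectively
  and continuously into a Hausdorff product. Hence weakly compact sets are weakly closed, and
  closures stay inside compact supersets.\<close>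

lemma kc_space_weak_topology: "kc_space (weak_topology :: 'a::real_normed_vector topology)"
proof (rule kc_space_continuous_injective_map_preimage[OF _ continuous_map_weak_topology])
  have "Hausdorff_space (product_topology (\<lambda>_ :: 'a \<Rightarrow>\<^sub>L real. euclidean :: real topology) UNIV)"
    by (simp add: Hausdorff_space_product_topology)
  then show "kc_space (euclidean :: (('a \<Rightarrow>\<^sub>L real) \<Rightarrow> real) topology)"
    by (simp add: euclidean_product_topology Hausdorff_imp_kc_space)
  show "inj_on (\<lambda>x (f :: 'a \<Rightarrow>\<^sub>L real). blinfun_apply f x) (topspace weak_topology)"
  proof (rule inj_onI)
    fix x y :: 'a
    assume "(\<lambda>f :: 'a \<Rightarrow>\<^sub>L real. blinfun_apply f x) = (\<lambda>f. blinfun_apply f y)"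
    then have eq: "blinfun_apply f (x - y) = 0" for f :: "'a \<Rightarrow>\<^sub>L real"
      by (simp add: blinfun.diff_right) metis
    obtain f :: "'a \<Rightarrow>\<^sub>L real" where "blinfun_apply f (x - y) = norm (x - y)"
      using norm_attaining_functional[of "x - y"] by blast
    with eq show "x = y" by simp
  qed
qed

lemma weakly_null_relatively_weakly_compact:
  fixes b :: "nat \<Rightarrow> 'a::real_normed_vector"
  assumes "\<And>f :: 'a \<Rightarrow>\<^sub>L real. (\<lambda>n. blinfun_apply f (b n)) \<longlonglongrightarrow> 0"
  shows "relatively_weakly_compact (range b)"
proof -
  let ?e = "\<lambda>x (f :: 'a \<Rightarrow>\<^sub>L real). blinfun_apply f x"
  have lim: "(\<lambda>n. ?e (b n)) \<longlonglongrightarrow> ?e 0"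
    using assms by (simp add: tendsto_fun_iff blinfun.zero_right)
  \<comment> \<open>The limit \<open>0\<close> is added to obtain a compact set: the member of a
    cover that contains \<open>0\<close> contains all but finitely many terms.\<close>
  have compact: "compactin weak_topology (insert 0 (range b))"
    unfolding compactin_def
  proof (intro conjI allI impI)
    fix \<U> :: "'a set set"
    assume \<U>: "(\<forall>U\<in>\<U>. openin weak_topology U) \<and> insert 0 (range b) \<subseteq> \<Union>\<U>"
    then obtain U where U: "U \<in> \<U>" "0 \<in> U" by blast
    with \<U> obtain V where V: "open V" "U = ?e -` V"
      by (auto simp: weak_topology_def openin_pullback_topology)
    then have "eventually (\<lambda>n. ?e (b n) \<in> V) sequentially"
      using U(2) by (intro topological_tendstoD[OF lim]) auto
    then obtain N where N: "\<And>n. N \<le> n \<Longrightarrow> b n \<in> U"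
      using V(2) by (auto simp: eventually_sequentially)
    have "\<forall>n. \<exists>W\<in>\<U>. b n \<in> W" using \<U> by blast
    then obtain W where W: "\<And>n. W n \<in> \<U>" "\<And>n. b n \<in> W n" by metis
    have "insert 0 (range b) \<subseteq> \<Union>(insert U (W ` {..<N}))"
      using U(2) N W(2) by (auto simp: not_less) (meson lessThan_iff not_less)
    then show "\<exists>\<F>. finite \<F> \<and> \<F> \<subseteq> \<U> \<and> insert 0 (range b) \<subseteq> \<Union>\<F>"
      using U(1) W(1) by (intro exI[of _ "insert U (W ` {..<N})"]) auto
  qed simp
  then have "closedin weak_topology (insert 0 (range b))"
    by (rule compactin_imp_closedin_gen[OF kc_space_weak_topology])
  then have "weak_topology closure_of range b \<subseteq> insert 0 (range b)"
    by (intro closure_of_minimal) auto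
  then show ?thesis
    unfolding relatively_weakly_compact_def
    by (rule closed_compactin[OF compact]) simp
qed

lemma relatively_weakly_compact_singleton: "relatively_weakly_compact {x :: 'a::real_normed_vector}"
proof -
  have "compactin weak_topology {x}" by simp
  then have "closedin weak_topology {x}"
    by (rule compactin_imp_closedin_gen[OF kc_space_weak_topology])
  then show ?thesis by (simp add: relatively_weakly_compact_def closure_of_closedin)
qed

section \<open>Selection of subsequences and the gliding hump\<close>

text \<open>Dependent choice sees only the previous state, so the state \<open>S k\<close> is a
  finite set that keeps all earlier choices, with its maximum as the current index. A step then
  meets finitely many conditions that hold eventually along \<open>G\<close>. The first argument of
  \<open>Q\<close> is the stage, so tolerances may shrink.\<close>

lemma strict_mono_pairwise_choice:
  fixes Q :: "nat \<Rightarrow> nat \<Rightarrow> nat \<Rightarrow> bool"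
  assumes "G \<noteq> bot" "G \<le> sequentially" "\<And>k m. eventually (Q k m) G"
  obtains \<sigma> :: "nat \<Rightarrow> nat" where "strict_mono \<sigma>" "\<And>j k. j < k \<Longrightarrow> Q k (\<sigma> j) (\<sigma> k)"
proof -
  have step: "\<exists>T. (finite T \<and> T \<noteq> {}) \<and> S \<subseteq> T \<and> Max S < Max T \<and> (\<forall>m\<in>S. Q (Suc k) m (Max T))"
    if S: "finite S \<and> S \<noteq> {}" for S :: "nat set" and k
  proof -
    have "eventually (\<lambda>n. Max S < n) G"
      using assms(2) eventually_gt_at_top by (rule filter_leD)
    moreover have "eventually (\<lambda>n. \<forall>m\<in>S. Q (Suc k) m n) G"
      using S assms(3) by (simp add: eventually_ball_finite_distrib)
    ultimately have "eventually (\<lambda>n. Max S < n \<and> (\<forall>m\<in>S. Q (Suc k) m n)) G"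
      by (rule eventually_conj)
    then obtain n where n: "Max S < n" "\<forall>m\<in>S. Q (Suc k) m n"
      using eventually_happens' assms(1) by blast
    have "Max (insert n S) = n" using S n(1) by (simp add: max_absorb1 less_imp_le del: Max_less_iff)
    then show ?thesis using S n by (intro exI[of _ "insert n S"]) auto
  qed
  have "\<exists>S. \<forall>k. (finite (S k) \<and> S k \<noteq> {}) \<and> (S k \<subseteq> S (Suc k) \<and> Max (S k) < Max (S (Suc k)) \<and>
      (\<forall>m\<in>S k. Q (Suc k) m (Max (S (Suc k)))))"
  proof (rule dependent_nat_choice)
    show "\<exists>S :: nat set. finite S \<and> S \<noteq> {}" by (intro exI[of _ "{0}"]) simp
  qed (rule step)
  then obtain S where S: "\<And>k. Max (S k) \<in> S k" "\<And>k. S k \<subseteq> S (Suc k)"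
      "\<And>k. Max (S k) < Max (S (Suc k))" "\<And>k m. m \<in> S k \<Longrightarrow> Q (Suc k) m (Max (S (Suc k)))"
    using Max_in by metis
  have mono: "S j \<subseteq> S k" if "j \<le> k" for j k
    using lift_Suc_mono_le[of S, OF S(2) that] .
  have "Q k (Max (S j)) (Max (S k))" if "j < k" for j k
  proof -
    obtain l where l: "k = Suc l" "j \<le> l" using \<open>j < k\<close> by (cases k) auto
    then show ?thesis using S(1)[of j] mono[of j l] S(4) by blast
  qed
  moreover have "strict_mono (\<lambda>k. Max (S k))" by (simp add: strict_mono_Suc_iff S(3))
  ultimately show ?thesis using that[of "\<lambda>k. Max (S k)"] by blast
qed

lemma not_tendsto_zero_subseq:
  fixes X :: "nat \<Rightarrow> 'a::real_normed_vector"
  assumes "\<not> X \<longlonglongrightarrow> 0"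
  obtains \<epsilon> and r :: "nat \<Rightarrow> nat" where "0 < \<epsilon>" "strict_mono r" "\<And>n. \<epsilon> \<le> norm (X (r n))"
proof -
  obtain \<epsilon> where \<epsilon>: "0 < \<epsilon>" "\<forall>N. \<exists>n\<ge>N. \<epsilon> \<le> norm (X n)"
    using assms by (auto simp: LIMSEQ_iff not_less)
  then have "infinite {n. \<epsilon> \<le> norm (X n)}" by (auto simp: infinite_nat_iff_unbounded_le)
  then obtain r :: "nat \<Rightarrow> nat" where "strict_mono r" "\<And>n. r n \<in> {n. \<epsilon> \<le> norm (X n)}"
    using infinite_enumerate by metis
  with \<epsilon>(1) show ?thesis by (intro that[of \<epsilon> r]) auto
qed

text \<open>A gliding hump argument. It replaces the appeal to the Schur property of \<open>\<ell>\<^sub>1\<close> for the operator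
  \<open>v \<mapsto> (h i v)\<^sub>i\<close>, and avoids the Eberlein-Smulian theorem by using cluster points along filters.\<close>

lemma gliding_hump:
  fixes h :: "nat \<Rightarrow> 'a::real_normed_vector \<Rightarrow>\<^sub>L real"
  assumes bound: "\<And>I v. finite I \<Longrightarrow> (\<Sum>i\<in>I. \<bar>blinfun_apply (h i) v\<bar>) \<le> C * norm v"
    and A: "relatively_weakly_compact A" "\<And>n. a n \<in> A"
    and \<epsilon>: "0 < \<epsilon>" "\<And>n. \<epsilon> \<le> \<bar>blinfun_apply (h n) (a n)\<bar>"
  shows False
proof -
  obtain y G where G: "G \<noteq> bot" "G \<le> sequentially"
      "\<And>f :: 'a \<Rightarrow>\<^sub>L real. ((\<lambda>n. blinfun_apply f (a n)) \<longlongrightarrow> blinfun_apply f y) G"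
    by (rule relatively_weakly_compact_cluster_point[OF A(1), of a, OF A(2)]) (rule that)
  define v where "v n = a n - y" for n
  have h_null: "(\<lambda>i. blinfun_apply (h i) w) \<longlonglongrightarrow> 0" for w
  proof -
    have "summable (\<lambda>i. \<bar>blinfun_apply (h i) w\<bar>)"
      by (rule bounded_imp_summable[of _ "C * norm w"]) (simp_all add: bound)
    then have "(\<lambda>i. \<bar>blinfun_apply (h i) w\<bar>) \<longlonglongrightarrow> 0" by (rule summable_LIMSEQ_zero)
    then show ?thesis by (simp only: tendsto_rabs_zero_iff)
  qed
  \<comment> \<open>Both off-diagonal values are made small. The tolerances
    \<open>\<epsilon> / 8 * (1/2) ^ k\<close> add up to \<open>\<epsilon> / 4\<close> over all
    stages.\<close>
  define Q where "Q k m n \<longleftrightarrow> \<bar>blinfun_apply (h m) (v n)\<bar> < \<epsilon> / 8 * (1/2) ^ k \<and>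
      \<bar>blinfun_apply (h n) (v m)\<bar> < \<epsilon> / 8 * (1/2) ^ k" for k m n :: nat
  have "eventually (Q k m) G" for k m
  proof -
    have e: "0 < \<epsilon> / 8 * (1/2) ^ k" using \<epsilon>(1) by simp
    have "((\<lambda>n. blinfun_apply (h m) (v n)) \<longlongrightarrow> 0) G"
      using tendsto_diff[OF G(3)[of "h m"] tendsto_const[of "blinfun_apply (h m) y"]]
      by (simp add: v_def blinfun.diff_right)
    from tendstoD[OF this e] have "eventually (\<lambda>n. \<bar>blinfun_apply (h m) (v n)\<bar> < \<epsilon> / 8 * (1/2) ^ k) G"
      by (simp only: dist_real_def diff_zero)
    moreover have "eventually (\<lambda>n. \<bar>blinfun_apply (h n) (v m)\<bar> < \<epsilon> / 8 * (1/2) ^ k) G"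
      using tendstoD[OF tendsto_mono[OF G(2) h_null] e] by (simp only: dist_real_def diff_zero)
    ultimately show ?thesis unfolding Q_def by (rule eventually_conj)
  qed
  then obtain \<sigma> where \<sigma>: "strict_mono \<sigma>" "\<And>j k. j < k \<Longrightarrow> Q k (\<sigma> j) (\<sigma> k)"
    by (rule strict_mono_pairwise_choice[OF G(1,2), of Q]) (use that in blast)+
  have abs_bound: "(\<Sum>j<N. \<bar>blinfun_apply (h (\<sigma> j)) w\<bar>) \<le> C * norm w" for N w
    using bound[of "\<sigma> ` {..<N}" w] \<sigma>(1)
    by (simp add: sum.reindex strict_mono_imp_inj_on)
  have abs_summable: "summable (\<lambda>j. \<bar>blinfun_apply (h (\<sigma> j)) w\<bar>)" for w
    using abs_bound[where w=w] by (intro summableI_nonneg_bounded[of _ "C * norm w"]) auto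
  then have summable: "summable (\<lambda>j. blinfun_apply (h (\<sigma> j)) w)" for w
    by (rule summable_rabs_cancel)
  \<comment> \<open>The sum of the selected functionals is bounded by \<open>C\<close>; at
    \<open>v (\<sigma> k)\<close> it nearly equals its diagonal term.\<close>
  define \<phi> where "\<phi> w = (\<Sum>j. blinfun_apply (h (\<sigma> j)) w)" for w
  have "bounded_linear \<phi>"
  proof (rule bounded_linear_intro)
    show "\<phi> (w + w') = \<phi> w + \<phi> w'" for w w'
      by (simp add: \<phi>_def blinfun.add_right suminf_add summable)
    show "\<phi> (c *\<^sub>R w) = c *\<^sub>R \<phi> w" for c w
      by (simp add: \<phi>_def blinfun.scaleR_right suminf_mult summable)
    show "norm (\<phi> w) \<le> norm w * C" for w
    proof -
      have "norm (\<phi> w) \<le> (\<Sum>j. \<bar>blinfun_apply (h (\<sigma> j)) w\<bar>)"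
        unfolding \<phi>_def real_norm_def by (rule summable_rabs[OF abs_summable])
      also have "\<dots> \<le> C * norm w" by (rule suminf_le_const[OF abs_summable abs_bound])
      finally show ?thesis by (simp add: mult.commute)
    qed
  qed
  then have \<phi>_blinfun: "blinfun_apply (Blinfun \<phi>) = \<phi>" by (rule bounded_linear_Blinfun_apply)
  \<comment> \<open>The two halves of \<open>Q\<close> cover \<open>j < k\<close> and
    \<open>k < j\<close>; the common bound depends on \<open>j\<close> only and is summable.\<close>
  have small: "\<bar>blinfun_apply (h (\<sigma> j)) (v (\<sigma> k))\<bar> \<le> \<epsilon> / 8 * (1/2) ^ j" if "j \<noteq> k" for j k
  proof (cases "j < k")
    case True
    have "(1/2 :: real) ^ k \<le> (1/2) ^ j" using True by (intro power_decreasing) auto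
    then have "\<epsilon> / 8 * (1/2) ^ k \<le> \<epsilon> / 8 * (1/2) ^ j" using \<epsilon>(1) by (intro mult_left_mono) auto
    then show ?thesis using \<sigma>(2)[OF True] unfolding Q_def by linarith
  next
    case False
    then have "Q j (\<sigma> k) (\<sigma> j)" using that \<sigma>(2) by simp
    then show ?thesis by (simp add: Q_def)
  qed
  \<comment> \<open>The series \<open>?g\<close> is \<open>\<phi> (v (\<sigma> k))\<close> without
    its diagonal term and costs at most \<open>\<epsilon> / 4\<close>. The value at \<open>y\<close>
    enters because \<open>v n = a n - y\<close>.\<close>
  have lower: "3 * \<epsilon> / 4 \<le> \<bar>\<phi> (v (\<sigma> k))\<bar> + \<bar>blinfun_apply (h (\<sigma> k)) y\<bar>" for k
  proof -
    let ?f = "\<lambda>j. blinfun_apply (h (\<sigma> j)) (v (\<sigma> k))"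
    let ?g = "\<lambda>j. ?f j - (if j = k then ?f j else 0)"
    have "?g sums (\<phi> (v (\<sigma> k)) - ?f k)"
      unfolding \<phi>_def by (intro sums_diff sums_single summable_sums summable)
    then have "\<bar>\<phi> (v (\<sigma> k)) - ?f k\<bar> = norm (suminf ?g)" by (simp add: sums_iff)
    also have "\<dots> \<le> (\<Sum>j. \<epsilon> / 8 * (1/2) ^ j)"
      using small[of _ k] \<epsilon>(1) by (intro norm_suminf_le summable_mult summable_geometric) auto
    also have "\<dots> = \<epsilon> / 8 * (1 / (1 - 1/2))"
      by (rule sums_unique[symmetric], intro sums_mult geometric_sums) simp
    finally have "\<bar>\<phi> (v (\<sigma> k)) - ?f k\<bar> \<le> \<epsilon> / 4" by simp
    moreover have "\<epsilon> \<le> \<bar>?f k\<bar> + \<bar>blinfun_apply (h (\<sigma> k)) y\<bar>"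
      using \<epsilon>(2)[of "\<sigma> k"] by (simp add: v_def blinfun.diff_right)
    ultimately show ?thesis by linarith
  qed
  \<comment> \<open>The filter \<open>G\<close> need not be carried by the range of
    \<open>\<sigma>\<close>, so a fresh cluster point of the subsequence is taken. All
    \<open>h (\<sigma> j)\<close>, and hence \<open>\<phi>\<close>, agree at \<open>y'\<close> and
    \<open>y\<close>, so \<open>\<phi> (v (\<sigma> k))\<close> tends to zero along
    \<open>G'\<close>, against the lower bound.\<close>
  obtain y' G' where G': "G' \<noteq> bot" "G' \<le> sequentially"
      "\<And>f :: 'a \<Rightarrow>\<^sub>L real. ((\<lambda>k. blinfun_apply f (a (\<sigma> k))) \<longlongrightarrow> blinfun_apply f y') G'"
    by (rule relatively_weakly_compact_cluster_point[OF A(1), of "\<lambda>k. a (\<sigma> k)", OF A(2)]) (rule that)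
  have "blinfun_apply (h (\<sigma> j)) y' = blinfun_apply (h (\<sigma> j)) y" for j
  proof -
    have "(\<lambda>k. blinfun_apply (h (\<sigma> j)) (v (\<sigma> k))) \<longlonglongrightarrow> 0"
    proof (rule Lim_null_comparison)
      show "eventually (\<lambda>k. norm (blinfun_apply (h (\<sigma> j)) (v (\<sigma> k))) \<le> \<epsilon> / 8 * (1/2) ^ k) sequentially"
        using eventually_gt_at_top[of j] by eventually_elim (use \<sigma>(2) in \<open>auto simp: Q_def less_imp_le\<close>)
      show "(\<lambda>k. \<epsilon> / 8 * (1/2) ^ k) \<longlonglongrightarrow> 0"
        by (intro tendsto_mult_right_zero LIMSEQ_realpow_zero) auto
    qed
    then have "((\<lambda>k. blinfun_apply (h (\<sigma> j)) (a (\<sigma> k)) - blinfun_apply (h (\<sigma> j)) y) \<longlongrightarrow> 0) G'"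
      using tendsto_mono[OF G'(2)] by (simp add: v_def blinfun.diff_right)
    moreover have "((\<lambda>k. blinfun_apply (h (\<sigma> j)) (a (\<sigma> k)) - blinfun_apply (h (\<sigma> j)) y) \<longlongrightarrow>
        blinfun_apply (h (\<sigma> j)) y' - blinfun_apply (h (\<sigma> j)) y) G'"
      by (intro tendsto_diff G' tendsto_const)
    ultimately show ?thesis using tendsto_unique[OF G'(1)] by fastforce
  qed
  then have "\<phi> y' = \<phi> y" by (simp add: \<phi>_def)
  then have "((\<lambda>k. \<phi> (v (\<sigma> k))) \<longlongrightarrow> 0) G'"
    using tendsto_diff[OF G'(3)[of "Blinfun \<phi>", unfolded \<phi>_blinfun] tendsto_const[of "\<phi> y"]]
    by (simp add: v_def bounded_linear.linear[OF \<open>bounded_linear \<phi>\<close>] linear_diff)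
  moreover have "((\<lambda>k. blinfun_apply (h (\<sigma> k)) y) \<longlongrightarrow> 0) G'"
    using LIMSEQ_subseq_LIMSEQ[OF h_null[of y] \<sigma>(1)] tendsto_mono[OF G'(2)] by (simp add: comp_def)
  ultimately have "((\<lambda>k. \<bar>\<phi> (v (\<sigma> k))\<bar> + \<bar>blinfun_apply (h (\<sigma> k)) y\<bar>) \<longlongrightarrow> 0) G'"
    by (intro tendsto_add_zero tendsto_rabs_zero)
  then have "3 * \<epsilon> / 4 \<le> 0"
    by (rule tendsto_lowerbound) (use lower G'(1) in \<open>auto intro: always_eventually\<close>)
  with \<epsilon>(1) show False by simp
qed

lemma absolutely_summable_functionals_null:
  fixes h :: "nat \<Rightarrow> 'a::real_normed_vector \<Rightarrow>\<^sub>L real"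
  assumes bound: "\<And>I v. finite I \<Longrightarrow> (\<Sum>i\<in>I. \<bar>blinfun_apply (h i) v\<bar>) \<le> C * norm v"
    and A: "relatively_weakly_compact A" "\<And>n. a n \<in> A"
  shows "(\<lambda>n. blinfun_apply (h n) (a n)) \<longlonglongrightarrow> 0"
proof (rule ccontr)
  assume "\<not> ?thesis"
  then obtain \<epsilon> and r :: "nat \<Rightarrow> nat" where r: "0 < \<epsilon>" "strict_mono r"
      "\<And>n. \<epsilon> \<le> norm (blinfun_apply (h (r n)) (a (r n)))"
    using not_tendsto_zero_subseq by blast
  have "(\<Sum>i\<in>I. \<bar>blinfun_apply (h (r i)) v\<bar>) \<le> C * norm v" if "finite I" for I v
    using bound[of "r ` I" v] that r(2)
    by (simp add: sum.reindex strict_mono_imp_inj_on)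
  then show False
    by (rule gliding_hump[of "\<lambda>n. h (r n)" C A "\<lambda>n. a (r n)" \<epsilon>]) (use A r in auto)
qed

section \<open>Disjoint sequences in solid hulls\<close>

lemma mem_solid_hull_iff: "x \<in> solid_hull A \<longleftrightarrow> (\<exists>a\<in>A. \<bar>x\<bar> \<le> \<bar>a\<bar>)"
  unfolding solid_hull_def by (auto simp: abs_le_iff minus_le_iff)

lemma lattice_seminorm_positive_functional:
  assumes "op_le 0 (g :: 'a::banach_lattice \<Rightarrow>\<^sub>L real)"
  shows "lattice_seminorm (\<lambda>x. blinfun_apply g \<bar>x\<bar>)"
proof -
  have mono: "blinfun_apply g x \<le> blinfun_apply g y" if "x \<le> y" for x y
    using assms that unfolding op_le_def by (metis blinfun.diff_right blinfun.zero_left diff_ge_0_iff_ge)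
  show ?thesis
    unfolding lattice_seminorm_def
    by (auto simp: abs_scaleR blinfun.scaleR_right intro: mono)
      (metis abs_triangle_ineq blinfun.add_right mono)
qed

text \<open>Let \<open>\<rho>\<close> be the seminorm given by a positive \<open>g\<close>
  dominating \<open>f\<close>. Its band seminorms for the disjoint \<open>x n\<close> add up to at
  most \<open>\<rho>\<close>, so functionals below them that norm the majorants \<open>a n\<close>
  are absolutely summable and vanish along \<open>a n\<close>. Finally
  \<open>\<bar>f (x n)\<bar> \<le> \<rho> (x n) \<le> p n (a n)\<close>.\<close>

lemma disjoint_seq_solid_hull_weakly_null:
  fixes A :: "'a::banach_lattice set" and f :: "'a \<Rightarrow>\<^sub>L real"
  assumes A: "relatively_weakly_compact A" and x: "disjoint_seq x" "range x \<subseteq> solid_hull A"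
  shows "(\<lambda>n. blinfun_apply f (x n)) \<longlonglongrightarrow> 0"
proof -
  have "\<exists>a\<in>A. \<bar>x n\<bar> \<le> \<bar>a\<bar>" for n using x(2) mem_solid_hull_iff by blast
  then obtain a where a: "\<And>n. a n \<in> A" "\<And>n. \<bar>x n\<bar> \<le> \<bar>a n\<bar>" by metis
  obtain g :: "'a \<Rightarrow>\<^sub>L real" where g: "op_le 0 g" "\<And>x. \<bar>blinfun_apply f x\<bar> \<le> blinfun_apply g \<bar>x\<bar>"
    using positive_functional_dominating by blast
  let ?\<rho> = "\<lambda>v. blinfun_apply g \<bar>v\<bar>"
  define p where "p n = band_seminorm ?\<rho> (x n)" for n
  have \<rho>: "lattice_seminorm ?\<rho>" by (rule lattice_seminorm_positive_functional[OF g(1)])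
  then have p: "lattice_seminorm (p n)" for n
    unfolding p_def by (rule lattice_seminorm_band_seminorm)
  have \<rho>_norm: "?\<rho> v \<le> norm g * norm v" for v
    using norm_blinfun[of g "\<bar>v\<bar>"] by simp
  have p_norm: "p n v \<le> norm g * norm v" for n v
    using band_seminorm_le[OF \<rho>, of "x n" v] \<rho>_norm[of v] by (simp add: p_def)
  \<comment> \<open>For fixed \<open>k\<close> the truncations of \<open>\<bar>v\<bar>\<close> are
    disjoint and below \<open>\<bar>v\<bar>\<close>, so their sum is too; then \<open>k\<close>
    tends to infinity.\<close>
  have sum_p: "(\<Sum>i<N. p i v) \<le> ?\<rho> v" for N v
  proof (rule LIMSEQ_le_const2)
    show "(\<lambda>k. \<Sum>i<N. ?\<rho> (inf \<bar>v\<bar> (real k *\<^sub>R \<bar>x i\<bar>))) \<longlonglongrightarrow> (\<Sum>i<N. p i v)"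
      unfolding p_def by (intro tendsto_sum band_seminorm_LIMSEQ \<rho>)
    have "(\<Sum>i<N. ?\<rho> (inf \<bar>v\<bar> (real k *\<^sub>R \<bar>x i\<bar>))) \<le> ?\<rho> v" for k
    proof -
      let ?d = "\<lambda>i. inf \<bar>v\<bar> (real k *\<^sub>R \<bar>x i\<bar>)"
      have "sum ?d {..<N} \<le> \<bar>v\<bar>"
      proof (rule sum_disjoint_le)
        show "disjoint_seq ?d"
          by (rule disjoint_seq_mono[OF x(1), of "\<lambda>_. real k"]) (auto simp: abs_inf_scaleR_abs)
      qed (auto intro: scaleR_nonneg_nonneg)
      moreover have "0 \<le> sum ?d {..<N}"
        by (intro sum_nonneg le_infI scaleR_nonneg_nonneg) auto
      ultimately have "?\<rho> (sum ?d {..<N}) \<le> ?\<rho> v"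
        by (intro lattice_seminormD(3)[OF \<rho>]) simp
      then show ?thesis
        using \<open>0 \<le> sum ?d {..<N}\<close> by (simp add: blinfun.sum_right abs_inf_scaleR_abs)
    qed
    then show "\<exists>K. \<forall>k\<ge>K. (\<Sum>i<N. ?\<rho> (inf \<bar>v\<bar> (real k *\<^sub>R \<bar>x i\<bar>))) \<le> ?\<rho> v" by blast
  qed
  have "\<exists>h :: 'a \<Rightarrow>\<^sub>L real. (\<forall>v. \<bar>blinfun_apply h v\<bar> \<le> p n v) \<and> blinfun_apply h (a n) = p n (a n)" for n
  proof -
    obtain h :: "'a \<Rightarrow>\<^sub>L real" where "\<And>v. \<bar>blinfun_apply h v\<bar> \<le> p n v" "blinfun_apply h (a n) = p n (a n)"
      by (rule hahn_banach_seminorm[of "p n" "norm g" "a n",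
          OF lattice_seminormD(1)[OF p] lattice_seminorm_scaleR[OF p] p_norm]) (rule that)
    then show ?thesis by blast
  qed
  then obtain h :: "nat \<Rightarrow> 'a \<Rightarrow>\<^sub>L real" where
    h: "\<And>n v. \<bar>blinfun_apply (h n) v\<bar> \<le> p n v" "\<And>n. blinfun_apply (h n) (a n) = p n (a n)" by metis
  have "(\<Sum>i\<in>I. \<bar>blinfun_apply (h i) v\<bar>) \<le> norm g * norm v" if I: "finite I" for I v
  proof -
    obtain N where "I \<subseteq> {..<N}" using finite_nat_bounded[OF I] by blast
    then have "(\<Sum>i\<in>I. \<bar>blinfun_apply (h i) v\<bar>) \<le> (\<Sum>i<N. \<bar>blinfun_apply (h i) v\<bar>)"
      by (intro sum_mono2) auto
    also have "\<dots> \<le> (\<Sum>i<N. p i v)" by (intro sum_mono h)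
    also have "\<dots> \<le> norm g * norm v" using sum_p \<rho>_norm by (rule order_trans)
    finally show ?thesis .
  qed
  then have lim: "(\<lambda>n. blinfun_apply (h n) (a n)) \<longlonglongrightarrow> 0"
    by (rule absolutely_summable_functionals_null[OF _ A a(1)])
  have "norm (blinfun_apply f (x n)) \<le> blinfun_apply (h n) (a n)" for n
    using g(2)[of "x n"] band_seminorm_ge[OF \<rho> a(2), of n] by (simp add: h(2) p_def)
  then show ?thesis by (intro Lim_null_comparison[OF _ lim] always_eventually allI)
qed

section \<open>L-weakly compact sets\<close>

lemma Lwc_set_dominated:
  assumes "Lwc_set A" "\<And>b. b \<in> B \<Longrightarrow> \<exists>a\<in>A. \<bar>b\<bar> \<le> \<bar>a\<bar>"
  shows "Lwc_set B"
proof -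
  have "solid_hull B \<subseteq> solid_hull A"
    using assms(2) by (auto simp: mem_solid_hull_iff) (meson order_trans)
  with assms(1) show ?thesis by (auto simp: Lwc_set_def)
qed

text \<open>Truncating \<open>u n\<close> at a suitable multiple of \<open>\<bar>y n\<bar>\<close>
  attains the band seminorm up to \<open>1 / Suc n\<close>. The truncations inherit disjointness
  from \<open>y\<close> and membership in the solid hull from \<open>u\<close>, so they are
  norm-null.\<close>

lemma Lwc_set_band_norm_null:
  assumes B: "Lwc_set B" "\<And>n. u n \<in> B" and y: "disjoint_seq y"
  shows "(\<lambda>n. band_seminorm norm (y n) (u n)) \<longlonglongrightarrow> 0"
proof -
  have "\<exists>k. band_seminorm norm (y n) (u n) - 1 / Suc n < norm (inf \<bar>u n\<bar> (real k *\<^sub>R \<bar>y n\<bar>))" for n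
    using less_cSUP_iff[OF _ band_seminorm_bdd[OF lattice_seminorm_norm],
        of "band_seminorm norm (y n) (u n) - 1 / Suc n" "u n" "y n"]
    by (simp add: band_seminorm_def[symmetric])
  then obtain k where k: "\<And>n. band_seminorm norm (y n) (u n) - 1 / Suc n <
      norm (inf \<bar>u n\<bar> (real (k n) *\<^sub>R \<bar>y n\<bar>))" by metis
  define z where "z n = inf \<bar>u n\<bar> (real (k n) *\<^sub>R \<bar>y n\<bar>)" for n
  have "disjoint_seq z"
    by (rule disjoint_seq_mono[OF y, of "\<lambda>n. real (k n)"]) (auto simp: z_def abs_inf_scaleR_abs)
  moreover have "z n \<in> solid_hull B" for n
    unfolding mem_solid_hull_iff
    using B(2) by (intro bexI[of _ "u n"]) (simp_all add: z_def abs_inf_scaleR_abs)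
  then have "range z \<subseteq> solid_hull B" by blast
  ultimately have "z \<longlonglongrightarrow> 0" using B(1) by (simp add: Lwc_set_def)
  then have lim: "(\<lambda>n. norm (z n) + 1 / Suc n) \<longlonglongrightarrow> 0"
    by (intro tendsto_add_zero tendsto_norm_zero LIMSEQ_Suc[OF lim_1_over_n]) auto
  have "norm (band_seminorm norm (y n) (u n)) \<le> norm (z n) + 1 / Suc n" for n
    using k[of n] lattice_seminorm_nonneg[OF lattice_seminorm_band_seminorm[OF lattice_seminorm_norm], of "y n" "u n"]
    by (simp add: z_def)
  then show ?thesis by (intro Lim_null_comparison[OF _ lim] always_eventually allI)
qed

subsection \<open>Dominated sets of operators\<close>

lemma positive_operatorD:
  assumes "T \<in> positive_operators"
  shows "0 \<le> x \<Longrightarrow> 0 \<le> blinfun_apply T x" "x \<le> y \<Longrightarrow> blinfun_apply T x \<le> blinfun_apply T y"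
    "\<bar>blinfun_apply T x\<bar> \<le> blinfun_apply T \<bar>x\<bar>"
proof -
  show nonneg: "0 \<le> blinfun_apply T x" if "0 \<le> x" for x
    using assms that by (simp add: positive_operators_def op_le_def)
  show mono: "blinfun_apply T x \<le> blinfun_apply T y" if "x \<le> y" for x y
    using nonneg[of "y - x"] that by (simp add: blinfun.diff_right)
  show "\<bar>blinfun_apply T x\<bar> \<le> blinfun_apply T \<bar>x\<bar>"
    using mono[of x "\<bar>x\<bar>"] mono[of "- x" "\<bar>x\<bar>"]
    by (intro abs_leI) (simp_all add: blinfun.minus_right abs_ge_self abs_ge_minus_self)
qed

lemma abs_op_le:
  assumes "S \<in> positive_operators" "op_le S T"
  shows "\<bar>blinfun_apply S x\<bar> \<le> blinfun_apply T \<bar>x\<bar>"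
  using positive_operatorD(3)[OF assms(1), of x] assms(2) order_trans
  unfolding op_le_def by (metis abs_ge_zero)

lemma norm_mono_op_le:
  assumes "S \<in> positive_operators" "op_le S T"
  shows "norm S \<le> norm T"
proof (rule norm_blinfun_bound)
  fix x
  have "\<bar>blinfun_apply S x\<bar> \<le> \<bar>blinfun_apply T \<bar>x\<bar>\<bar>"
    using abs_op_le[OF assms] abs_ge_self by (rule order_trans)
  then have "norm (blinfun_apply S x) \<le> norm (blinfun_apply T \<bar>x\<bar>)" by (rule norm_mono_abs)
  also have "\<dots> \<le> norm T * norm x" using norm_blinfun[of T "\<bar>x\<bar>"] by simp
  finally show "norm (blinfun_apply S x) \<le> norm T * norm x" .
qed simp

lemma bounded_dominated:
  assumes "\<S> \<subseteq> positive_operators" "dominated_by \<S> \<T>" "bounded \<T>"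
  shows "bounded \<S>"
proof -
  obtain M where "\<And>T. T \<in> \<T> \<Longrightarrow> norm T \<le> M" using assms(3) by (auto simp: bounded_iff)
  then have "norm S \<le> M" if "S \<in> \<S>" for S
    using assms(1,2) that norm_mono_op_le unfolding dominated_by_def by (meson order_trans subsetD)
  then show ?thesis by (auto simp: bounded_iff)
qed

text \<open>For \<open>s\<close> dominated by \<open>t\<close> and
  \<open>\<bar>a\<bar> \<le> b\<close>, positivity gives
  \<open>\<bar>s a\<bar> \<le> t \<bar>a\<bar> \<le> t b\<close>. The set \<open>B\<close> of
  majorants is left free: moduli of the elements of \<open>A\<close>, or a single element.\<close>

lemma Lwc_set_operators_image_dominated:
  assumes S: "\<S> \<subseteq> positive_operators" "dominated_by \<S> \<T>" and T: "\<T> \<subseteq> positive_operators"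
    and B: "Lwc_set (operators_image \<T> B)" "\<And>a. a \<in> A \<Longrightarrow> \<exists>b\<in>B. \<bar>a\<bar> \<le> b"
  shows "Lwc_set (operators_image \<S> A)"
proof (rule Lwc_set_dominated[OF B(1)])
  fix z assume "z \<in> operators_image \<S> A"
  then obtain s a where s: "s \<in> \<S>" "a \<in> A" "z = blinfun_apply s a" by (auto simp: operators_image_def)
  obtain t where t: "t \<in> \<T>" "op_le s t" using s(1) S(2) by (auto simp: dominated_by_def)
  obtain b where b: "b \<in> B" "\<bar>a\<bar> \<le> b" using B(2)[OF s(2)] by blast
  have "\<bar>z\<bar> \<le> blinfun_apply t \<bar>a\<bar>" using s S(1) t(2) by (simp add: abs_op_le subsetD)
  also have "\<dots> \<le> blinfun_apply t b"
    using t(1) T b(2) by (intro positive_operatorD(2)) auto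
  also have "\<dots> \<le> \<bar>blinfun_apply t b\<bar>" by (rule abs_ge_self)
  finally show "\<exists>w\<in>operators_image \<T> B. \<bar>z\<bar> \<le> \<bar>w\<bar>"
    using t(1) b(1) by (auto simp: operators_image_def)
qed

text \<open>The functionals \<open>h n\<close> norming the images \<open>S n (a n)\<close> on the band of \<open>y n\<close> give the weak* null
  sequence \<open>h n \<circ> S n\<close>, because only the singletons enter its convergence.\<close>

lemma Lwc_set_operators_image_limited:
  fixes \<S> :: "('e::banach_lattice \<Rightarrow>\<^sub>L 'f::banach_lattice) set"
  assumes single: "\<And>x. Lwc_set (operators_image \<S> {x})" and A: "limited_set A"
  shows "Lwc_set (operators_image \<S> A)"
  unfolding Lwc_set_def
proof (intro allI impI, elim conjE)
  fix y :: "nat \<Rightarrow> 'f"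
  assume y: "disjoint_seq y" "range y \<subseteq> solid_hull (operators_image \<S> A)"
  have "\<exists>s a. s \<in> \<S> \<and> a \<in> A \<and> \<bar>y n\<bar> \<le> \<bar>blinfun_apply s a\<bar>" for n
  proof -
    have "y n \<in> solid_hull (operators_image \<S> A)" using y(2) by blast
    then show ?thesis by (auto simp: mem_solid_hull_iff operators_image_def)
  qed
  then obtain s a where sa: "\<And>n. s n \<in> \<S>" "\<And>n. a n \<in> A" "\<And>n. \<bar>y n\<bar> \<le> \<bar>blinfun_apply (s n) (a n)\<bar>"
    by metis
  define p where "p n = band_seminorm norm (y n)" for n
  have p: "lattice_seminorm (p n)" for n
    unfolding p_def by (intro lattice_seminorm_band_seminorm lattice_seminorm_norm)
  have p_norm: "p n v \<le> 1 * norm v" for n v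
    using band_seminorm_le[OF lattice_seminorm_norm] by (simp add: p_def)
  have "\<exists>h :: 'f \<Rightarrow>\<^sub>L real. (\<forall>v. \<bar>blinfun_apply h v\<bar> \<le> p n v) \<and>
      blinfun_apply h (blinfun_apply (s n) (a n)) = p n (blinfun_apply (s n) (a n))" for n
  proof -
    obtain h :: "'f \<Rightarrow>\<^sub>L real" where "\<And>v. \<bar>blinfun_apply h v\<bar> \<le> p n v"
        "blinfun_apply h (blinfun_apply (s n) (a n)) = p n (blinfun_apply (s n) (a n))"
      by (rule hahn_banach_seminorm[of "p n" 1 "blinfun_apply (s n) (a n)",
          OF lattice_seminormD(1)[OF p] lattice_seminorm_scaleR[OF p] p_norm]) (rule that)
    then show ?thesis by blast
  qed
  then obtain h :: "nat \<Rightarrow> 'f \<Rightarrow>\<^sub>L real" where h: "\<And>n v. \<bar>blinfun_apply (h n) v\<bar> \<le> p n v"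
      "\<And>n. blinfun_apply (h n) (blinfun_apply (s n) (a n)) = p n (blinfun_apply (s n) (a n))"
    by metis
  have "weak_star_null (\<lambda>n. h n o\<^sub>L s n)"
    unfolding weak_star_null_def
  proof
    fix x
    have "(\<lambda>n. p n (blinfun_apply (s n) x)) \<longlonglongrightarrow> 0"
      unfolding p_def
      by (rule Lwc_set_band_norm_null[OF single[of x] _ y(1)]) (use sa(1) in \<open>auto simp: operators_image_def\<close>)
    then show "(\<lambda>n. blinfun_apply (h n o\<^sub>L s n) x) \<longlonglongrightarrow> 0"
      by (rule Lim_null_comparison[rotated]) (simp add: h(1))
  qed
  then have unif: "uniform_limit A (\<lambda>n. blinfun_apply (h n o\<^sub>L s n)) (\<lambda>_. 0) sequentially"
    using A by (simp add: limited_set_def)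
  show "y \<longlonglongrightarrow> 0"
  proof (rule LIMSEQ_I)
    fix e :: real assume "0 < e"
    from uniform_limitD[OF unif this] obtain N where
      N: "\<And>n v. N \<le> n \<Longrightarrow> v \<in> A \<Longrightarrow> \<bar>blinfun_apply (h n) (blinfun_apply (s n) v)\<bar> < e"
      by (auto simp: eventually_sequentially dist_real_def)
    have "norm (y n) < e" if "N \<le> n" for n
    proof -
      \<comment> \<open>Uniform convergence on \<open>A\<close> is evaluated at the moving point
        \<open>a n\<close>, where \<open>h n\<close> attains the seminorm.\<close>
      have "norm (y n) \<le> p n (blinfun_apply (s n) (a n))"
        unfolding p_def by (rule band_seminorm_ge[OF lattice_seminorm_norm sa(3)])
      then show ?thesis using N[OF that sa(2)[of n]] h(2)[of n] by linarith
    qed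
    then show "\<exists>N. \<forall>n\<ge>N. norm (y n - 0) < e" by auto
  qed
qed

text \<open>Subtracting a large multiple of the preceding terms and a small multiple of a common
  majorant makes a sequence of positive elements disjoint.\<close>

lemma disjoint_seq_pprt_diff:
  fixes x :: "nat \<Rightarrow> 'a::banach_lattice"
  assumes x: "\<And>n. 0 \<le> x n" and z: "\<And>n. (1/2) ^ n *\<^sub>R x n \<le> z"
  shows "disjoint_seq (\<lambda>n. pprt (x n - (4 ^ n *\<^sub>R sum x {..<n} + (1/2) ^ n *\<^sub>R z)))"
    (is "disjoint_seq ?b")
proof -
  have z0: "0 \<le> z" using x[of 0] z[of 0] by simp
  have disj: "inf (?b m) (?b n) = 0" if "m < n" for m n
  proof -
    \<comment> \<open>Up to scaling, the later element lies below the positive part of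
      \<open>u\<close> and the earlier one below its negative part, and these parts are
      disjoint.\<close>
    define u where "u = x n - 4 ^ n *\<^sub>R x m"
    have "sum x {m} \<le> sum x {..<n}" using that by (intro sum_mono2) (auto intro: x)
    then have "x m \<le> sum x {..<n}" by simp
    then have "4 ^ n *\<^sub>R x m \<le> 4 ^ n *\<^sub>R sum x {..<n}" by (rule scaleR_left_mono) simp
    moreover have "0 \<le> (1/2) ^ n *\<^sub>R z" by (intro scaleR_nonneg_nonneg z0) simp
    ultimately have "4 ^ n *\<^sub>R x m \<le> 4 ^ n *\<^sub>R sum x {..<n} + (1/2) ^ n *\<^sub>R z"
      by (rule add_increasing2[rotated])
    then have 1: "?b n \<le> 1 *\<^sub>R pprt u" unfolding u_def by (simp add: diff_left_mono)
    have 2: "?b m \<le> (1/4) ^ n *\<^sub>R pprt (- u)"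
    proof -
      \<comment> \<open>As \<open>m < n\<close>, the multiple of \<open>z\<close> subtracted in the
        earlier element majorizes \<open>(1/4) ^ n *\<^sub>R x n\<close>.\<close>
      have "(1/4) ^ n *\<^sub>R x n \<le> (1/2) ^ m *\<^sub>R (1/2) ^ n *\<^sub>R x n"
      proof -
        have "(1/4 :: real) ^ n = (1/2) ^ n * (1/2) ^ n"
          by (subst power_mult_distrib[symmetric]) simp
        also have "\<dots> \<le> (1/2) ^ m * (1/2) ^ n"
          using that by (intro mult_right_mono power_decreasing) auto
        finally show ?thesis using x[of n] by (simp add: scaleR_right_mono)
      qed
      also have "\<dots> \<le> (1/2) ^ m *\<^sub>R z" by (intro scaleR_left_mono z) simp
      also have "\<dots> \<le> 4 ^ m *\<^sub>R sum x {..<m} + (1/2) ^ m *\<^sub>R z"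
        by (intro add_increasing scaleR_nonneg_nonneg sum_nonneg x) auto
      finally have "x m - (4 ^ m *\<^sub>R sum x {..<m} + (1/2) ^ m *\<^sub>R z) \<le> x m - (1/4) ^ n *\<^sub>R x n"
        by (rule diff_left_mono)
      also have "\<dots> = (1/4) ^ n *\<^sub>R (- u)"
      proof -
        have "(1/4 :: real) ^ n * 4 ^ n = 1" by (subst power_mult_distrib[symmetric]) simp
        then show ?thesis by (simp only: u_def minus_diff_eq scaleR_diff_right scaleR_scaleR scaleR_one)
      qed
      also have "\<dots> \<le> (1/4) ^ n *\<^sub>R pprt (- u)"
        by (intro scaleR_left_mono) (auto simp: pprt_def)
      finally show ?thesis
        unfolding pprt_def[of "x m - _"] by (intro le_supI scaleR_nonneg_nonneg) simp_all
    qed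
    have "pprt u - pprt (- u) = u" by (simp only: pprt_neg diff_minus_eq_add prts[symmetric])
    then have "pprt u = pprt u - inf (pprt u) (pprt (- u))"
      using pprt_eq_diff_inf[of "pprt u" "pprt (- u)"] by (simp only:)
    then have "inf (pprt u) (pprt (- u)) = 0"
      by (simp only: eq_diff_eq add_cancel_left_right)
    then have "inf (1 *\<^sub>R pprt u) ((1/4) ^ n *\<^sub>R pprt (- u)) = 0"
      by (intro inf_scaleR_eq_zero) auto
    then have "inf (?b n) (?b m) = 0" by (rule inf_eq_zero_mono[OF _ _ 1 _ 2]) auto
    then show ?thesis by (simp add: inf_commute)
  qed
  have "inf (?b i) (?b j) = 0" if "i \<noteq> j" for i j
    using disj[of i j] disj[of j i] inf_commute[of "?b i" "?b j"] that
    by (cases i j rule: linorder_cases) simp_all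
  then show ?thesis by (simp add: disjoint_seq_def abs_of_nonneg)
qed

text \<open>The majorant is the sum of the series, which converges by completeness; it lies above
  each term because the positive cone is closed.\<close>

lemma dyadic_majorant:
  fixes x :: "nat \<Rightarrow> 'a::banach_lattice"
  assumes "\<And>n. 0 \<le> x n" "bounded (range x)"
  obtains z where "\<And>n. (1/2) ^ n *\<^sub>R x n \<le> z"
proof
  let ?t = "\<lambda>n. (1/2 :: real) ^ n *\<^sub>R x n"
  obtain M where M: "\<And>n. norm (x n) \<le> M" using assms(2) by (auto simp: bounded_iff)
  have "summable ?t"
    by (rule summable_comparison_test'[of "\<lambda>n. (1/2) ^ n * M"])
      (auto intro!: summable_mult2 summable_geometric mult_left_mono M)
  then have lim: "(\<lambda>N. \<Sum>i<N. ?t i) \<longlonglongrightarrow> suminf ?t" by (rule summable_LIMSEQ)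
  show "?t n \<le> suminf ?t" for n
  proof -
    \<comment> \<open>The shift by \<open>Suc n\<close> makes every partial sum contain the term
      with index \<open>n\<close>.\<close>
    have "(\<lambda>N. (\<Sum>i<N + Suc n. ?t i) - ?t n) \<longlonglongrightarrow> suminf ?t - ?t n"
      by (intro tendsto_diff tendsto_const LIMSEQ_ignore_initial_segment lim)
    moreover have "0 \<le> (\<Sum>i<N + Suc n. ?t i) - ?t n" for N
    proof -
      have "?t n = sum ?t {n}" by simp
      also have "\<dots> \<le> (\<Sum>i<N + Suc n. ?t i)"
        by (rule sum_mono2) (auto intro!: scaleR_nonneg_nonneg assms(1))
      finally show ?thesis by (simp only: diff_ge_0_iff_ge)
    qed
    ultimately have "0 \<le> suminf ?t - ?t n" by (rule nonneg_if_limit_nonneg)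
    then show ?thesis by (simp only: diff_ge_0_iff_ge)
  qed
qed

text \<open>The hypothesis \<open>Lwc\<close> is applied only to singletons and to the range of a
  disjoint sequence \<open>b\<close> in the solid hull of \<open>A\<close>. The former make the
  seminorms \<open>q n\<close> tend to zero pointwise, the latter makes them small at
  \<open>b\<close>; together this contradicts \<open>\<epsilon> \<le> q n (x n)\<close>.\<close>

lemma Lwc_set_operators_image_abs:
  fixes \<T> :: "('e::banach_lattice \<Rightarrow>\<^sub>L 'f::banach_lattice) set"
  assumes T: "\<T> \<subseteq> positive_operators"
    and Lwc: "\<And>A. relatively_weakly_compact A \<Longrightarrow> Lwc_set (operators_image \<T> A)"
    and A: "relatively_weakly_compact A"
  shows "Lwc_set (operators_image \<T> (abs ` A))"
  unfolding Lwc_set_def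
proof (intro allI impI, elim conjE)
  fix y' :: "nat \<Rightarrow> 'f"
  assume y': "disjoint_seq y'" "range y' \<subseteq> solid_hull (operators_image \<T> (abs ` A))"
  show "y' \<longlonglongrightarrow> 0"
  proof (rule ccontr)
    assume "\<not> y' \<longlonglongrightarrow> 0"
    then obtain \<epsilon> and r :: "nat \<Rightarrow> nat" where r: "0 < \<epsilon>" "strict_mono r" "\<And>n. \<epsilon> \<le> norm (y' (r n))"
      using not_tendsto_zero_subseq by blast
    define y where "y = y' \<circ> r"
    have y: "disjoint_seq y" "\<And>n. \<epsilon> \<le> norm (y n)"
      using disjoint_seq_subseq[OF y'(1) r(2)] r(3) by (auto simp: y_def)
    have "\<exists>t a. t \<in> \<T> \<and> a \<in> A \<and> \<bar>y n\<bar> \<le> \<bar>blinfun_apply t \<bar>a\<bar>\<bar>" for n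
    proof -
      have "y n \<in> solid_hull (operators_image \<T> (abs ` A))" using y'(2) by (auto simp: y_def)
      then show ?thesis by (auto simp: mem_solid_hull_iff operators_image_def)
    qed
    then obtain t a where ta: "\<And>n. t n \<in> \<T>" "\<And>n. a n \<in> A" "\<And>n. \<bar>y n\<bar> \<le> \<bar>blinfun_apply (t n) \<bar>a n\<bar>\<bar>"
      by metis
    define x where "x n = \<bar>a n\<bar>" for n
    define q where "q n v = band_seminorm norm (y n) (blinfun_apply (t n) v)" for n v
    have sn: "lattice_seminorm (band_seminorm norm (y n))" for n
      by (intro lattice_seminorm_band_seminorm lattice_seminorm_norm)
    have q_add: "q n (u + v) \<le> q n u + q n v" for n u v
      unfolding q_def by (simp add: blinfun.add_right lattice_seminormD(1)[OF sn])
    have q_scale: "q n (c *\<^sub>R v) = \<bar>c\<bar> * q n v" for n c v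
      unfolding q_def by (simp add: blinfun.scaleR_right lattice_seminorm_scaleR[OF sn])
    have q_sum: "q n (sum f I) \<le> (\<Sum>i\<in>I. q n (f i))" for n f and I :: "nat set"
      unfolding q_def blinfun.sum_right by (rule lattice_seminorm_sum[OF sn])
    have q_nonneg: "0 \<le> q n v" for n v
      unfolding q_def by (rule lattice_seminorm_nonneg[OF sn])
    have q_mono: "q n u \<le> q n v" if "0 \<le> u" "u \<le> v" for n u v
    proof -
      have t: "t n \<in> positive_operators" using T ta(1) by blast
      have "0 \<le> blinfun_apply (t n) u" "blinfun_apply (t n) u \<le> blinfun_apply (t n) v"
        using positive_operatorD(1,2)[OF t] that by auto
      then show ?thesis
        unfolding q_def by (intro lattice_seminormD(3)[OF sn]) (metis abs_ge_self abs_of_nonneg order_trans)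
    qed
    have q_ge: "\<epsilon> \<le> q n (x n)" for n
      using band_seminorm_ge[OF lattice_seminorm_norm ta(3)[of n]] y(2)[of n] by (simp add: q_def x_def)
    have q_null: "(\<lambda>n. q n u) \<longlonglongrightarrow> 0" for u
      unfolding q_def
      by (rule Lwc_set_band_norm_null[OF Lwc[OF relatively_weakly_compact_singleton[of u]] _ y(1)])
        (use ta(1) in \<open>auto simp: operators_image_def\<close>)
    \<comment> \<open>Chosen so that \<open>k\<close> terms below \<open>\<delta> k\<close>,
      multiplied by \<open>4 ^ k\<close>, contribute at most \<open>\<epsilon> / 4\<close>; the
      summand 1 avoids division by zero at \<open>k = 0\<close>.\<close>
    define \<delta> where "\<delta> k = \<epsilon> / 4 / 4 ^ k / (real k + 1)" for k :: nat
    have \<delta>: "0 < \<delta> k" for k using r(1) by (simp add: \<delta>_def)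
    have "eventually (\<lambda>n. q n (x m) < \<delta> k) sequentially" for k m
      using order_tendstoD(2)[OF q_null \<delta>] .
    then obtain \<sigma> where \<sigma>: "strict_mono \<sigma>" "\<And>j k. j < k \<Longrightarrow> q (\<sigma> k) (x (\<sigma> j)) < \<delta> k"
      by (rule strict_mono_pairwise_choice[of sequentially "\<lambda>k m n. q n (x m) < \<delta> k", rotated 2])
        (use that in auto)
    have "bounded (range (\<lambda>n. x (\<sigma> n)))"
      using relatively_weakly_compact_imp_bounded[OF A] ta(2) by (auto simp: bounded_iff x_def)
    then obtain z where z: "\<And>n. (1/2) ^ n *\<^sub>R x (\<sigma> n) \<le> z"
      using dyadic_majorant[of "\<lambda>n. x (\<sigma> n)"] by (auto simp: x_def)
    \<comment> \<open>This is the amount whose subtraction makes the sequence disjoint;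
      \<open>q (\<sigma> k)\<close> is at most \<open>\<epsilon> / 4\<close> on its first summand
      and vanishes in the limit on its second.\<close>
    define w where "w k = 4 ^ k *\<^sub>R (\<Sum>i<k. x (\<sigma> i)) + (1/2) ^ k *\<^sub>R z" for k
    define b where "b k = pprt (x (\<sigma> k) - w k)" for k
    have z0: "0 \<le> z" using z[of 0] order_trans[of 0 "x (\<sigma> 0)" z] by (simp add: x_def)
    have w0: "0 \<le> w k" for k
      unfolding w_def by (intro add_nonneg_nonneg scaleR_nonneg_nonneg sum_nonneg z0) (auto simp: x_def)
    have b_disj: "disjoint_seq b"
      unfolding b_def w_def by (rule disjoint_seq_pprt_diff) (use z in \<open>auto simp: x_def\<close>)
    have "\<bar>b k\<bar> \<le> \<bar>a (\<sigma> k)\<bar>" for k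
      using w0[of k] by (simp add: b_def abs_of_nonneg) (simp add: pprt_def x_def)
    then have "b k \<in> solid_hull A" for k
      unfolding mem_solid_hull_iff by (rule bexI[OF _ ta(2)])
    then have "range b \<subseteq> solid_hull A" by blast
    \<comment> \<open>Being disjoint in the solid hull of \<open>A\<close>, the sequence
      \<open>b\<close> is weakly null, so \<open>Lwc\<close> applies to its range.\<close>
    then have "relatively_weakly_compact (range b)"
      using disjoint_seq_solid_hull_weakly_null[OF A b_disj] by (intro weakly_null_relatively_weakly_compact)
    then have "Lwc_set (operators_image \<T> (range b))" by (rule Lwc)
    then have q_b: "(\<lambda>k. q (\<sigma> k) (b k)) \<longlonglongrightarrow> 0"
      unfolding q_def
      by (rule Lwc_set_band_norm_null[OF _ _ disjoint_seq_subseq[OF y(1) \<sigma>(1), unfolded comp_def]])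
        (use ta(1) in \<open>auto simp: operators_image_def\<close>)
    have q_z: "(\<lambda>k. q (\<sigma> k) z) \<longlonglongrightarrow> 0"
      using LIMSEQ_subseq_LIMSEQ[OF q_null[of z] \<sigma>(1)] by (simp add: comp_def)
    have "3 * \<epsilon> / 4 \<le> q (\<sigma> k) (b k) + q (\<sigma> k) z" for k
    proof -
      have le: "x (\<sigma> k) \<le> b k + w k"
        by (simp add: b_def pprt_def add_sup_distrib_right)
      have "q (\<sigma> k) (\<Sum>i<k. x (\<sigma> i)) \<le> (\<Sum>i<k. \<delta> k)"
        by (rule order_trans[OF q_sum sum_mono]) (use \<sigma>(2) in \<open>auto intro: less_imp_le\<close>)
      then have "4 ^ k * q (\<sigma> k) (\<Sum>i<k. x (\<sigma> i)) \<le> 4 ^ k * (real k * \<delta> k)"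
        by (intro mult_left_mono) auto
      also have "\<dots> \<le> 4 ^ k * ((real k + 1) * \<delta> k)"
        using \<delta>[of k] by (intro mult_left_mono mult_right_mono) auto
      also have "(real k + 1) * \<delta> k = \<epsilon> / 4 / 4 ^ k"
        by (simp add: \<delta>_def)
      also have "4 ^ k * (\<epsilon> / 4 / 4 ^ k) = \<epsilon> / 4" by simp
      finally have 1: "q (\<sigma> k) (4 ^ k *\<^sub>R (\<Sum>i<k. x (\<sigma> i))) \<le> \<epsilon> / 4" by (simp add: q_scale)
      have "(1/2 :: real) ^ k \<le> 1" by (intro power_le_one) auto
      then have 2: "q (\<sigma> k) ((1/2) ^ k *\<^sub>R z) \<le> q (\<sigma> k) z"
        by (simp only: q_scale abs_of_nonneg zero_le_power) (simp add: mult_left_le_one_le q_nonneg q_scale)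
      have "\<epsilon> \<le> q (\<sigma> k) (x (\<sigma> k))" by (rule q_ge)
      also have "\<dots> \<le> q (\<sigma> k) (b k + w k)" by (rule q_mono[OF _ le]) (simp add: x_def)
      also have "\<dots> \<le> q (\<sigma> k) (b k) + q (\<sigma> k) (w k)" by (rule q_add)
      also have "q (\<sigma> k) (w k) \<le> q (\<sigma> k) (4 ^ k *\<^sub>R (\<Sum>i<k. x (\<sigma> i))) + q (\<sigma> k) ((1/2) ^ k *\<^sub>R z)"
        unfolding w_def by (rule q_add)
      finally show ?thesis using 1 2 by linarith
    qed
    then have "3 * \<epsilon> / 4 \<le> 0"
      by (intro LIMSEQ_le_const[OF tendsto_add_zero[OF q_b q_z]]) auto
    with r(1) show False by simp
  qed
qed

section \<open>Suprema of functionals over sets of operators\<close>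

text \<open>The chain \<open>\<bar>f n (s x)\<bar> \<le> g \<bar>s x\<bar> \<le> g (t
  \<bar>x\<bar>)\<close> compares the suprema. A single \<open>g\<close> for all \<open>f n\<close>
  covers a fixed functional as well as an order bounded sequence.\<close>

lemma SUP_functional_dominated_tendsto_zero:
  fixes \<S> \<T> :: "('e::banach_lattice \<Rightarrow>\<^sub>L 'f::banach_lattice) set"
    and f :: "nat \<Rightarrow> 'f \<Rightarrow>\<^sub>L real" and g :: "'f \<Rightarrow>\<^sub>L real"
  assumes S: "\<S> \<subseteq> positive_operators" "dominated_by \<S> \<T>"
    and g: "op_le 0 g" and fg: "\<And>n v. \<bar>blinfun_apply (f n) v\<bar> \<le> blinfun_apply g \<bar>v\<bar>"
    and lim: "(\<lambda>n. SUP T\<in>\<T>. ennreal \<bar>blinfun_apply g (blinfun_apply T \<bar>x n\<bar>)\<bar>) \<longlonglongrightarrow> 0"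
  shows "(\<lambda>n. SUP S\<in>\<S>. ennreal \<bar>blinfun_apply (f n) (blinfun_apply S (x n))\<bar>) \<longlonglongrightarrow> 0"
proof (rule tendsto_sandwich[OF _ _ tendsto_const lim])
  have g_pos: "g \<in> positive_operators" using g by (simp add: positive_operators_def)
  have "(SUP S\<in>\<S>. ennreal \<bar>blinfun_apply (f n) (blinfun_apply S (x n))\<bar>) \<le>
      (SUP T\<in>\<T>. ennreal \<bar>blinfun_apply g (blinfun_apply T \<bar>x n\<bar>)\<bar>)" for n
  proof (rule SUP_mono)
    fix s assume s: "s \<in> \<S>"
    then obtain t where t: "t \<in> \<T>" "op_le s t" using S(2) by (auto simp: dominated_by_def)
    have "\<bar>blinfun_apply (f n) (blinfun_apply s (x n))\<bar> \<le> blinfun_apply g \<bar>blinfun_apply s (x n)\<bar>"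
      by (rule fg)
    also have "\<dots> \<le> blinfun_apply g (blinfun_apply t \<bar>x n\<bar>)"
      using s S(1) t(2) by (intro positive_operatorD(2)[OF g_pos] abs_op_le) auto
    also have "\<dots> \<le> \<bar>blinfun_apply g (blinfun_apply t \<bar>x n\<bar>)\<bar>" by simp
    finally show "\<exists>t\<in>\<T>. ennreal \<bar>blinfun_apply (f n) (blinfun_apply s (x n))\<bar> \<le>
        ennreal \<bar>blinfun_apply g (blinfun_apply t \<bar>x n\<bar>)\<bar>"
      using t(1) by (auto intro: ennreal_leI)
  qed
  then show "eventually (\<lambda>n. (SUP S\<in>\<S>. ennreal \<bar>blinfun_apply (f n) (blinfun_apply S (x n))\<bar>) \<le>
      (SUP T\<in>\<T>. ennreal \<bar>blinfun_apply g (blinfun_apply T \<bar>x n\<bar>)\<bar>)) sequentially"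
    by simp
qed simp

text \<open>The sum of positive functionals dominating the two order bounds works on the cone;
  positive and negative parts extend the estimate to all vectors.\<close>

lemma order_bounded_functionals_dominated:
  fixes f :: "nat \<Rightarrow> 'a::banach_lattice \<Rightarrow>\<^sub>L real"
  assumes "order_bounded_functionals f"
  obtains g :: "'a \<Rightarrow>\<^sub>L real" where "op_le 0 g" "\<And>n v. \<bar>blinfun_apply (f n) v\<bar> \<le> blinfun_apply g \<bar>v\<bar>"
proof -
  obtain l u where lu: "\<And>n. op_le l (f n)" "\<And>n. op_le (f n) u"
    using assms by (auto simp: order_bounded_functionals_def)
  obtain l' :: "'a \<Rightarrow>\<^sub>L real" where l': "op_le 0 l'" "\<And>v. \<bar>blinfun_apply l v\<bar> \<le> blinfun_apply l' \<bar>v\<bar>"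
    using positive_functional_dominating by blast
  obtain u' :: "'a \<Rightarrow>\<^sub>L real" where u': "op_le 0 u'" "\<And>v. \<bar>blinfun_apply u v\<bar> \<le> blinfun_apply u' \<bar>v\<bar>"
    using positive_functional_dominating by blast
  have pos: "\<bar>blinfun_apply (f n) v\<bar> \<le> blinfun_apply (l' + u') v" if "0 \<le> v" for n v
  proof -
    have "blinfun_apply l v \<le> blinfun_apply (f n) v" "blinfun_apply (f n) v \<le> blinfun_apply u v"
      using lu that by (auto simp: op_le_def)
    then show ?thesis
      using l'(2)[of v] u'(2)[of v] that by (simp add: abs_of_nonneg blinfun.add_left)
  qed
  have "\<bar>blinfun_apply (f n) v\<bar> \<le> blinfun_apply (l' + u') \<bar>v\<bar>" for n v
  proof -
    have "blinfun_apply (f n) v = blinfun_apply (f n) (pprt v) - blinfun_apply (f n) (pprt (- v))"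
      using arg_cong[OF prts[of v], of "blinfun_apply (f n)"]
      by (simp add: pprt_neg blinfun.add_right blinfun.minus_right)
    moreover have "blinfun_apply (l' + u') \<bar>v\<bar> =
        blinfun_apply (l' + u') (pprt v) + blinfun_apply (l' + u') (pprt (- v))"
      by (simp add: abs_prts pprt_neg blinfun.diff_right blinfun.minus_right)
    ultimately show ?thesis using pos[of "pprt v" n] pos[of "pprt (- v)" n] by simp
  qed
  moreover have "op_le 0 (l' + u')" using l'(1) u'(1) by (simp add: op_le_def blinfun.add_left)
  ultimately show ?thesis using that by blast
qed

lemma disjoint_seq_abs: "disjoint_seq x \<Longrightarrow> disjoint_seq (\<lambda>n. \<bar>x n\<bar>)"
  by (simp add: disjoint_seq_def)

lemma limited_set_singleton: "limited_set {x :: 'a::real_normed_vector}"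
  unfolding limited_set_def weak_star_null_def uniform_limit_iff
proof (intro allI impI)
  fix f :: "nat \<Rightarrow> 'a \<Rightarrow>\<^sub>L real" and e :: real
  assume "\<forall>x. (\<lambda>n. blinfun_apply (f n) x) \<longlonglongrightarrow> 0" and e: "0 < e"
  then have "(\<lambda>n. blinfun_apply (f n) x) \<longlonglongrightarrow> 0" by blast
  from tendstoD[OF this e]
  show "eventually (\<lambda>n. \<forall>v\<in>{x}. dist (blinfun_apply (f n) v) 0 < e) sequentially" by simp
qed

theorem theorem5:
  fixes \<S> \<T> :: "('e::banach_lattice \<Rightarrow>\<^sub>L 'f::banach_lattice) set"
  assumes "\<S> \<subseteq> positive_operators" and "\<T> \<subseteq> positive_operators"
    and "dominated_by \<S> \<T>"
  shows "(KB_space TYPE('e) \<longrightarrow> \<T> \<in> a_Lwc \<longrightarrow> \<S> \<in> a_Lwc) \<and>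
         (\<T> \<in> l_Lwc \<longrightarrow> \<S> \<in> l_Lwc) \<and>
         (\<T> \<in> l_Mwc \<longrightarrow> \<S> \<in> l_Mwc) \<and>
         (\<T> \<in> o_Lwc \<longrightarrow> \<S> \<in> o_Lwc) \<and>
         (\<T> \<in> o_Mwc \<longrightarrow> \<S> \<in> o_Mwc)"
proof -
  note Lwc_dominated = Lwc_set_operators_image_dominated[OF assms(1,3,2)]
  note SUP_dominated = SUP_functional_dominated_tendsto_zero[OF assms(1,3)]
  have bounded: "bounded \<S>" if "bounded \<T>"
    using bounded_dominated[OF assms(1,3) that] .
  have abs_cball: "range (\<lambda>n. \<bar>x n\<bar>) \<subseteq> cball 0 1" if "range x \<subseteq> cball 0 1" for x :: "nat \<Rightarrow> 'e"
    using that by (auto simp: image_subset_iff)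
  \<comment> \<open>The majorants are the moduli of the elements of \<open>A\<close>, whose images
    under \<open>\<T>\<close> form an Lwc set.\<close>
  have "\<S> \<in> a_Lwc" if T: "\<T> \<in> a_Lwc"
  proof -
    have "Lwc_set (operators_image \<S> A)" if "relatively_weakly_compact A" for A
    proof (rule Lwc_dominated)
      show "Lwc_set (operators_image \<T> (abs ` A))"
        using T by (intro Lwc_set_operators_image_abs assms(2) that) (auto simp: a_Lwc_def)
    qed auto
    then show ?thesis using T bounded by (simp add: a_Lwc_def)
  qed
  \<comment> \<open>Domination is used on singletons, which are limited; the passage to an arbitrary
    limited set then takes place within \<open>\<S>\<close>.\<close>
  moreover have "\<S> \<in> l_Lwc" if T: "\<T> \<in> l_Lwc"
  proof -
    have "Lwc_set (operators_image \<S> {x})" for x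
    proof (rule Lwc_dominated)
      show "Lwc_set (operators_image \<T> {\<bar>x\<bar>})"
        using T limited_set_singleton by (auto simp: l_Lwc_def)
    qed auto
    then show ?thesis using T bounded Lwc_set_operators_image_limited by (auto simp: l_Lwc_def)
  qed
  moreover have "\<S> \<in> l_Mwc" if T: "\<T> \<in> l_Mwc"
  proof -
    have "(\<lambda>n. SUP S\<in>\<S>. ennreal \<bar>blinfun_apply f (blinfun_apply S (x n))\<bar>) \<longlonglongrightarrow> 0"
      if x: "disjoint_seq x" "range x \<subseteq> cball 0 1" for f x
    proof -
      obtain g :: "'f \<Rightarrow>\<^sub>L real" where g: "op_le 0 g" "\<And>v. \<bar>blinfun_apply f v\<bar> \<le> blinfun_apply g \<bar>v\<bar>"
        using positive_functional_dominating by blast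
      show ?thesis
        by (rule SUP_dominated[where f = "\<lambda>_. f", OF g])
          (use T disjoint_seq_abs[OF x(1)] abs_cball[OF x(2)] in \<open>simp add: l_Mwc_def\<close>)
    qed
    then show ?thesis using T bounded by (simp add: l_Mwc_def)
  qed
  moreover have "\<S> \<in> o_Lwc" if T: "\<T> \<in> o_Lwc"
  proof -
    have "Lwc_set (operators_image \<S> A)" if A: "order_bounded A" for A
    proof -
      obtain a b where ab: "A \<subseteq> {a..b}" using A by (auto simp: order_bounded_def)
      \<comment> \<open>One majorant serves the whole order interval, so the hypothesis on
        \<open>\<T>\<close> is applied to a singleton.\<close>
      have "\<bar>v\<bar> \<le> \<bar>a\<bar> + \<bar>b\<bar>" if "v \<in> A" for v
      proof (rule abs_leI)
        have v: "a \<le> v" "v \<le> b" using ab that by auto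
        show "v \<le> \<bar>a\<bar> + \<bar>b\<bar>"
          using order_trans[OF v(2) abs_ge_self] by (rule add_increasing[OF abs_ge_zero])
        have "- v \<le> \<bar>a\<bar>" using v(1) abs_ge_minus_self[of a] by (meson neg_le_iff_le order_trans)
        then show "- v \<le> \<bar>a\<bar> + \<bar>b\<bar>" by (rule add_increasing2[OF abs_ge_zero])
      qed
      moreover have "Lwc_set (operators_image \<T> {\<bar>a\<bar> + \<bar>b\<bar>})"
      proof -
        have "order_bounded {\<bar>a\<bar> + \<bar>b\<bar>}"
          unfolding order_bounded_def by (intro exI[of _ "\<bar>a\<bar> + \<bar>b\<bar>"]) simp
        then show ?thesis using T by (simp add: o_Lwc_def)
      qed
      ultimately show ?thesis by (intro Lwc_dominated) auto
    qed
    then show ?thesis using T bounded by (simp add: o_Lwc_def)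
  qed
  moreover have "\<S> \<in> o_Mwc" if T: "\<T> \<in> o_Mwc"
  proof -
    have "(\<lambda>n. SUP S\<in>\<S>. ennreal \<bar>blinfun_apply (f n) (blinfun_apply S (x n))\<bar>) \<longlonglongrightarrow> 0"
      if f: "order_bounded_functionals f" and x: "disjoint_seq x" "range x \<subseteq> cball 0 1" for f x
    proof -
      obtain g where g: "op_le 0 g" "\<And>n v. \<bar>blinfun_apply (f n) v\<bar> \<le> blinfun_apply g \<bar>v\<bar>"
        by (rule order_bounded_functionals_dominated[OF f]) (rule that)
      \<comment> \<open>The constant sequence \<open>g\<close> is order bounded by itself, so the
        hypothesis on \<open>\<T>\<close> applies to it and to the disjoint sequence of moduli of
        \<open>x\<close>.\<close>
      have "order_bounded_functionals (\<lambda>_. g)"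
        by (auto simp: order_bounded_functionals_def op_le_def)
      then show ?thesis
        by (intro SUP_dominated[OF g])
          (use T disjoint_seq_abs[OF x(1)] abs_cball[OF x(2)] in \<open>simp add: o_Mwc_def\<close>)
    qed
    then show ?thesis using T bounded by (simp add: o_Mwc_def)
  qed
  ultimately show ?thesis by blast
qed

end
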